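(* Let $E \subseteq \mathbb{R}$ be a set that is not simultaneously dense and co-dense in any nonempty open interval. If the boundary $\partial E$ of $E$ has positive coarse Minkowski dimension, then $(\mathbb{R}_{\mathrm{Vec}}, E)$ defines every bounded Borel subset of every $\mathbb{R}^m$. In particular, if $E$ is nowhere dense and has positive coarse Minkowski dimension, then $(\mathbb{R}_{\mathrm{Vec}}, E)$ defines every bounded Borel subset of every $\mathbb{R}^m$.
   Context: $\mathbb{R}_{\mathrm{Vec}}$ is the ordered real vector space $(\mathbb{R},<,+,0,(x \mapsto \lambda x)_{\lambda \in \mathbb{R}})$, and $(\mathbb{R}_{\mathrm{Vec}},E)$ is its expansion by a unary predicate for $E$. "Defines" means first-order definable with parameters from $\mathbb{R}$. For a bounded $X \subseteq \mathbb{R}^n$, $\mathscr{M}(1,X)$ is the minimum number of open balls of radius $1$ covering $X$; with $B_n(r)$ the open ball of radius $r$ centered at $0$, the coarse Minkowski dimension of $Z \subseteq \mathbb{R}^n$ is $\dim_{\mathrm{CM}}(Z) := \limsup_{r \to \infty} \frac{\log \mathscr{M}(1, B_n(r) \cap Z)}{\log r}$. *)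

theory Defs
  imports "HOL-Analysis.Analysis" "HOL-Library.Liminf_Limsup"
begin

text \<open>Terms: variables, real constants (parameters; 0 is the constant 0),
  addition, and scalar multiplication x \<mapsto> lambda x for every real lambda.\<close>
datatype trm = Var nat | Cst real | Plus trm trm | Smul real trm

datatype fm = Less trm trm | Equal trm trm | InE trm | Neg fm | Conj fm fm | Exists nat fm

primrec eval :: "(nat \<Rightarrow> real) \<Rightarrow> trm \<Rightarrow> real" where
  "eval \<sigma> (Var k) = \<sigma> k"
| "eval \<sigma> (Cst c) = c"
| "eval \<sigma> (Plus s t) = eval \<sigma> s + eval \<sigma> t"
| "eval \<sigma> (Smul l t) = l * eval \<sigma> t"

primrec sat :: "real set \<Rightarrow> (nat \<Rightarrow> real) \<Rightarrow> fm \<Rightarrow> bool" where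
  "sat E \<sigma> (Less s t) = (eval \<sigma> s < eval \<sigma> t)"
| "sat E \<sigma> (Equal s t) = (eval \<sigma> s = eval \<sigma> t)"
| "sat E \<sigma> (InE t) = (eval \<sigma> t \<in> E)"
| "sat E \<sigma> (Neg \<phi>) = (\<not> sat E \<sigma> \<phi>)"
| "sat E \<sigma> (Conj \<phi> \<psi>) = (sat E \<sigma> \<phi> \<and> sat E \<sigma> \<psi>)"
| "sat E \<sigma> (Exists x \<phi>) = (\<exists>a. sat E (\<sigma>(x := a)) \<phi>)"

definition defines_set :: "real set \<Rightarrow> (real ^ 'n) set \<Rightarrow> bool" where
  "defines_set E X \<longleftrightarrow>
     (\<exists>\<phi> (v :: 'n \<Rightarrow> nat). inj v \<and>
        X = {x. sat E (\<lambda>k. if k \<in> range v then x $ (inv v k) else 0) \<phi>})"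

definition cover_num :: "'a::metric_space set \<Rightarrow> nat" where
  "cover_num X = (LEAST k. \<exists>C. finite C \<and> card C = k \<and> X \<subseteq> (\<Union>c\<in>C. ball c 1))"

definition dim_CM :: "'a::real_normed_vector set \<Rightarrow> ereal" where
  "dim_CM Z = Limsup at_top
     (\<lambda>r::real. ereal (ln (real (cover_num (ball 0 r \<inter> Z))) / ln r))"

definition dense_in_interval :: "real set \<Rightarrow> real \<Rightarrow> real \<Rightarrow> bool" where
  "dense_in_interval A a b \<longleftrightarrow>
     (\<forall>c d. a \<le> c \<and> c < d \<and> d \<le> b \<longrightarrow> A \<inter> {c<..<d} \<noteq> {})"

definition no_dense_codense :: "real set \<Rightarrow> bool" where
  "no_dense_codense E \<longleftrightarrow>
     (\<forall>a b. a < b \<longrightarrow> \<not> (dense_in_interval E a b \<and> dense_in_interval (- E) a b))"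

definition nowhere_dense :: "'a::topological_space set \<Rightarrow> bool" where
  "nowhere_dense A \<longleftrightarrow> interior (closure A) = {}"

end

theory Submission
  imports Defs
begin

text \<open>Put \<open>D = frontier E\<close>, a closed definable set with empty interior. By the pigeonhole principle,
  positive coarse Minkowski dimension yields, for some \<open>k\<close> and every \<open>\<mu>\<close>, arbitrarily long
  difference vectors of \<open>k\<close>-tuples of points near \<open>D\<close> that are almost orthogonal to \<open>\<mu>\<close>; a tiny change
  of \<open>\<mu>\<close> moves their image under \<open>\<mu>\<close> anywhere. Hence (a Baire type argument) some linear image of such
  differences is dense in \<open>\<real>\<close>. Restricting to finite definable approximations of \<open>D\<close>, which grow
  with a real parameter, gives a definable dense set \<open>S\<close> with a definable order of type \<open>\<omega>\<close>.

  Three real parameters then code an arbitrary binary relation on \<open>S\<close>. The points of \<open>S\<close> which are,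
  at their time of arrival, the closest ones above \<open>c\<close> form a definable sequence that can be made as sparse
  as desired; at each of its members, the value coded by \<open>e\<close> is the \<open>z\<close> of the pair \<open>(p, z)\<close>
  seen so far for which \<open>p + \<theta> z\<close> is least above \<open>e\<close>. So one may quantify over subsets of \<open>S\<close>,
  and every Borel set, being analytic, becomes definable.\<close>

section \<open>Definability\<close>

primrec tvars :: "trm \<Rightarrow> nat set" where
  "tvars (Var k) = {k}"
| "tvars (Cst c) = {}"
| "tvars (Plus s t) = tvars s \<union> tvars t"
| "tvars (Smul l t) = tvars t"

text \<open>Bound variables are kept. This over-approximation of the free variables is still finite
  and still supports \<open>sat_cong\<close>, and no scopes have to be tracked when a fresh variable
  is chosen.\<close>

primrec fvars :: "fm \<Rightarrow> nat set" where
  "fvars (Less s t) = tvars s \<union> tvars t"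
| "fvars (Equal s t) = tvars s \<union> tvars t"
| "fvars (InE t) = tvars t"
| "fvars (Neg \<phi>) = fvars \<phi>"
| "fvars (Conj \<phi> \<psi>) = fvars \<phi> \<union> fvars \<psi>"
| "fvars (Exists x \<phi>) = fvars \<phi>"

lemma finite_tvars: "finite (tvars t)"
  by (induction t) auto

lemma finite_fvars: "finite (fvars \<phi>)"
  by (induction \<phi>) (auto simp: finite_tvars)

lemma eval_cong: "(\<And>k. k \<in> tvars t \<Longrightarrow> \<sigma> k = \<tau> k) \<Longrightarrow> eval \<sigma> t = eval \<tau> t"
  by (induction t) auto

lemma sat_cong: "(\<And>k. k \<in> fvars \<phi> \<Longrightarrow> \<sigma> k = \<tau> k) \<Longrightarrow> sat E \<sigma> \<phi> = sat E \<tau> \<phi>"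
proof (induction \<phi> arbitrary: \<sigma> \<tau>)
  case (Less s t)
  then show ?case using eval_cong[of s \<sigma> \<tau>] eval_cong[of t \<sigma> \<tau>] by simp
next
  case (Equal s t)
  then show ?case using eval_cong[of s \<sigma> \<tau>] eval_cong[of t \<sigma> \<tau>] by simp
next
  case (InE t)
  then show ?case using eval_cong[of t \<sigma> \<tau>] by simp
next
  case (Neg \<phi>)
  then show ?case by (metis fvars.simps(4) sat.simps(4))
next
  case (Conj \<phi>1 \<phi>2)
  then show ?case by (metis UnCI fvars.simps(5) sat.simps(5))
next
  case (Exists x \<phi>)
  have "sat E (\<sigma>(x := a)) \<phi> = sat E (\<tau>(x := a)) \<phi>" for a
    by (rule Exists.IH) (use Exists.prems in auto)
  then show ?case by simp
qed

primrec tsubst :: "(nat \<Rightarrow> trm) \<Rightarrow> trm \<Rightarrow> trm" where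
  "tsubst \<tau> (Var k) = \<tau> k"
| "tsubst \<tau> (Cst c) = Cst c"
| "tsubst \<tau> (Plus s t) = Plus (tsubst \<tau> s) (tsubst \<tau> t)"
| "tsubst \<tau> (Smul l t) = Smul l (tsubst \<tau> t)"

lemma eval_tsubst: "eval \<sigma> (tsubst \<tau> t) = eval (\<lambda>k. eval \<sigma> (\<tau> k)) t"
  by (induction t) auto

text \<open>Terms substituted under a quantifier could be captured, so the bound variable is renamed
  on the way: the induction hypothesis is used with \<open>x\<close> sent to \<open>Var y\<close>
  for a fresh \<open>y\<close>. The formula obtained depends on \<tau> and \<phi> but not on the
  assignment.\<close>

lemma sat_subst: "\<exists>\<psi>. \<forall>\<sigma>. sat E \<sigma> \<psi> = sat E (\<lambda>k. eval \<sigma> (\<tau> k)) \<phi>"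
proof (induction \<phi> arbitrary: \<tau>)
  case (Less s t)
  show ?case by (rule exI[of _ "Less (tsubst \<tau> s) (tsubst \<tau> t)"]) (simp add: eval_tsubst)
next
  case (Equal s t)
  show ?case by (rule exI[of _ "Equal (tsubst \<tau> s) (tsubst \<tau> t)"]) (simp add: eval_tsubst)
next
  case (InE t)
  show ?case by (rule exI[of _ "InE (tsubst \<tau> t)"]) (simp add: eval_tsubst)
next
  case (Neg \<phi>)
  then show ?case by (metis sat.simps(4))
next
  case (Conj \<phi>1 \<phi>2)
  then show ?case by (metis sat.simps(5))
next
  case (Exists x \<phi>)
  have "finite (\<Union>k\<in>fvars \<phi>. tvars (\<tau> k))"
    by (simp add: finite_fvars finite_tvars)
  then obtain y where y: "y \<notin> (\<Union>k\<in>fvars \<phi>. tvars (\<tau> k))"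
    using ex_new_if_finite infinite_UNIV_nat by blast
  obtain \<psi> where \<psi>: "\<And>\<sigma>. sat E \<sigma> \<psi> = sat E (\<lambda>k. eval \<sigma> ((\<tau>(x := Var y)) k)) \<phi>"
    using Exists.IH by metis
  have "sat E (\<sigma>(y := a)) \<psi> = sat E ((\<lambda>k. eval \<sigma> (\<tau> k))(x := a)) \<phi>" for \<sigma> a
    unfolding \<psi>
  proof (rule sat_cong)
    fix k assume k: "k \<in> fvars \<phi>"
    show "eval (\<sigma>(y := a)) ((\<tau>(x := Var y)) k) = ((\<lambda>k. eval \<sigma> (\<tau> k))(x := a)) k"
    proof (cases "k = x")
      case False
      have "eval (\<sigma>(y := a)) (\<tau> k) = eval \<sigma> (\<tau> k)"
        by (rule eval_cong) (use y k in auto)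
      then show ?thesis using False by simp
    qed simp
  qed
  then show ?case by (intro exI[of _ "Exists y \<psi>"]) simp
qed

section \<open>Definable predicates on assignments and their closure properties\<close>

definition linear_term :: "((nat \<Rightarrow> real) \<Rightarrow> real) \<Rightarrow> bool" where
  "linear_term f \<longleftrightarrow> (\<exists>t. \<forall>\<sigma>. eval \<sigma> t = f \<sigma>)"

text \<open>Definability is a property of HOL predicates on assignments, so formulas are never
  written out later: the introduction rules follow the shape of the predicate. Real parameters enter
  through \<open>linear_term_const\<close>.\<close>

definition definable :: "real set \<Rightarrow> ((nat \<Rightarrow> real) \<Rightarrow> bool) \<Rightarrow> bool" where
  "definable E P \<longleftrightarrow> (\<exists>\<phi>. \<forall>\<sigma>. sat E \<sigma> \<phi> \<longleftrightarrow> P \<sigma>)"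

lemma linear_term_var: "linear_term (\<lambda>\<sigma>. \<sigma> k)"
  unfolding linear_term_def by (rule exI[of _ "Var k"]) simp

lemma linear_term_const: "linear_term (\<lambda>\<sigma>. c)"
  unfolding linear_term_def by (rule exI[of _ "Cst c"]) simp

lemma linear_term_add: "linear_term f \<Longrightarrow> linear_term g \<Longrightarrow> linear_term (\<lambda>\<sigma>. f \<sigma> + g \<sigma>)"
  unfolding linear_term_def by (metis eval.simps(3))

lemma linear_term_mult: "linear_term f \<Longrightarrow> linear_term (\<lambda>\<sigma>. c * f \<sigma>)"
  unfolding linear_term_def by (metis eval.simps(4))

lemma linear_term_minus: "linear_term f \<Longrightarrow> linear_term (\<lambda>\<sigma>. - f \<sigma>)"
  using linear_term_mult[of f "-1"] by simp

lemma linear_term_diff: "linear_term f \<Longrightarrow> linear_term g \<Longrightarrow> linear_term (\<lambda>\<sigma>. f \<sigma> - g \<sigma>)"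
  using linear_term_add[of f "\<lambda>\<sigma>. - g \<sigma>"] linear_term_minus[of g] by simp

lemmas linear_term_intros =
  linear_term_var linear_term_const linear_term_add linear_term_mult
  linear_term_minus linear_term_diff

lemma definable_subst:
  assumes "definable E P" "\<And>k. linear_term (\<lambda>\<sigma>. f \<sigma> k)"
  shows "definable E (\<lambda>\<sigma>. P (f \<sigma>))"
proof -
  obtain \<phi> where \<phi>: "\<And>\<sigma>. sat E \<sigma> \<phi> \<longleftrightarrow> P \<sigma>" using assms(1) by (auto simp: definable_def)
  obtain \<tau> where \<tau>: "\<And>k \<sigma>. eval \<sigma> (\<tau> k) = f \<sigma> k"
    using assms(2) unfolding linear_term_def by metis
  obtain \<psi> where "\<And>\<sigma>. sat E \<sigma> \<psi> = sat E (\<lambda>k. eval \<sigma> (\<tau> k)) \<phi>"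
    using sat_subst[of E \<tau> \<phi>] by metis
  then show ?thesis unfolding definable_def by (intro exI[of _ \<psi>]) (simp add: \<phi> \<tau>)
qed

lemma definable_less:
  "linear_term f \<Longrightarrow> linear_term g \<Longrightarrow> definable E (\<lambda>\<sigma>. f \<sigma> < g \<sigma>)"
  unfolding linear_term_def definable_def by (metis sat.simps(1))

lemma definable_eq:
  "linear_term f \<Longrightarrow> linear_term g \<Longrightarrow> definable E (\<lambda>\<sigma>. f \<sigma> = g \<sigma>)"
  unfolding linear_term_def definable_def by (metis sat.simps(2))

lemma definable_mem: "linear_term f \<Longrightarrow> definable E (\<lambda>\<sigma>. f \<sigma> \<in> E)"
  unfolding linear_term_def definable_def by (metis sat.simps(3))

lemma definable_not: "definable E P \<Longrightarrow> definable E (\<lambda>\<sigma>. \<not> P \<sigma>)"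
  unfolding definable_def by (metis sat.simps(4))

lemma definable_conj:
  "definable E P \<Longrightarrow> definable E Q \<Longrightarrow> definable E (\<lambda>\<sigma>. P \<sigma> \<and> Q \<sigma>)"
  unfolding definable_def by (metis sat.simps(5))

lemma definable_disj:
  "definable E P \<Longrightarrow> definable E Q \<Longrightarrow> definable E (\<lambda>\<sigma>. P \<sigma> \<or> Q \<sigma>)"
  using definable_not[of E "\<lambda>\<sigma>. \<not> P \<sigma> \<and> \<not> Q \<sigma>"] definable_conj[of E "\<lambda>\<sigma>. \<not> P \<sigma>" "\<lambda>\<sigma>. \<not> Q \<sigma>"]
    definable_not[of E P] definable_not[of E Q] by simp

lemma definable_imp:
  "definable E P \<Longrightarrow> definable E Q \<Longrightarrow> definable E (\<lambda>\<sigma>. P \<sigma> \<longrightarrow> Q \<sigma>)"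
  unfolding imp_conv_disj by (intro definable_disj definable_not)

lemma definable_iff:
  "definable E P \<Longrightarrow> definable E Q \<Longrightarrow> definable E (\<lambda>\<sigma>. P \<sigma> \<longleftrightarrow> Q \<sigma>)"
  unfolding iff_conv_conj_imp by (intro definable_conj definable_imp)

lemma definable_le:
  "linear_term f \<Longrightarrow> linear_term g \<Longrightarrow> definable E (\<lambda>\<sigma>. f \<sigma> \<le> g \<sigma>)"
  using definable_not[OF definable_less, of g f E] by (simp add: not_less)

text \<open>Bound variables are handled in de Bruijn style: the witness becomes variable 0
  and the variables of the context are shifted up by one.\<close>

lemma definable_ex:
  assumes "definable E (\<lambda>\<sigma>. P (\<sigma> 0) (\<lambda>k. \<sigma> (Suc k)))"
  shows "definable E (\<lambda>\<sigma>. \<exists>a. P a \<sigma>)"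
proof -
  obtain \<phi> where \<phi>: "\<And>\<sigma>. sat E \<sigma> \<phi> \<longleftrightarrow> P (\<sigma> 0) (\<lambda>k. \<sigma> (Suc k))"
    using assms by (auto simp: definable_def)
  \<comment> \<open>Quantifying variable 0 leaves the context in the variables from 1 on;
    substituting \<open>\<sigma> (k - 1)\<close> for variable \<open>k\<close> shifts it back, and
    the truncated value at \<open>k = 0\<close> does no harm.\<close>
  have "definable E (\<lambda>\<sigma>. \<exists>a. P a (\<lambda>k. \<sigma> (Suc k)))"
    unfolding definable_def by (intro exI[of _ "Exists 0 \<phi>"]) (simp add: \<phi>)
  from definable_subst[OF this, of "\<lambda>\<sigma> k. \<sigma> (k - 1)"] show ?thesis
    by (simp add: linear_term_var)
qed

lemma definable_all:
  assumes "definable E (\<lambda>\<sigma>. P (\<sigma> 0) (\<lambda>k. \<sigma> (Suc k)))"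
  shows "definable E (\<lambda>\<sigma>. \<forall>a. P a \<sigma>)"
  using definable_not[OF definable_ex[of E "\<lambda>a \<sigma>. \<not> P a \<sigma>"]] definable_not[OF assms] by simp

lemma definable_False: "definable E (\<lambda>\<sigma>. False)"
  using definable_less[OF linear_term_const linear_term_const, of E 0 0] by simp

lemma definable_finite_ex:
  assumes "finite I" "\<And>i. i \<in> I \<Longrightarrow> definable E (P i)"
  shows "definable E (\<lambda>\<sigma>. \<exists>i\<in>I. P i \<sigma>)"
  using assms
proof (induction I rule: finite_induct)
  case empty
  then show ?case by (simp add: definable_False)
next
  case (insert x F)
  then show ?case using definable_disj[of E "P x" "\<lambda>\<sigma>. \<exists>i\<in>F. P i \<sigma>"] by simp
qed

lemma definable_finite_all:
  assumes "finite I" "\<And>i. i \<in> I \<Longrightarrow> definable E (P i)"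
  shows "definable E (\<lambda>\<sigma>. \<forall>i\<in>I. P i \<sigma>)"
  using definable_not[OF definable_finite_ex[of I E "\<lambda>i \<sigma>. \<not> P i \<sigma>"]] assms definable_not by simp

lemmas definable_intros =
  definable_less definable_eq definable_le definable_not definable_conj definable_disj
  definable_imp definable_iff definable_ex definable_all linear_term_intros

definition definable1 :: "real set \<Rightarrow> (real \<Rightarrow> bool) \<Rightarrow> bool" where
  "definable1 E R \<longleftrightarrow> definable E (\<lambda>\<sigma>. R (\<sigma> 0))"

definition definable2 :: "real set \<Rightarrow> (real \<Rightarrow> real \<Rightarrow> bool) \<Rightarrow> bool" where
  "definable2 E R \<longleftrightarrow> definable E (\<lambda>\<sigma>. R (\<sigma> 0) (\<sigma> 1))"

definition definable3 :: "real set \<Rightarrow> (real \<Rightarrow> real \<Rightarrow> real \<Rightarrow> bool) \<Rightarrow> bool" where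
  "definable3 E R \<longleftrightarrow> definable E (\<lambda>\<sigma>. R (\<sigma> 0) (\<sigma> 1) (\<sigma> 2))"

lemma definable1D:
  assumes "definable1 E R" "linear_term f"
  shows "definable E (\<lambda>\<sigma>. R (f \<sigma>))"
  using definable_subst[OF assms(1)[unfolded definable1_def], of "\<lambda>\<sigma> k. f \<sigma>"] assms(2) by simp

lemma definable2D:
  assumes "definable2 E R" "linear_term f" "linear_term g"
  shows "definable E (\<lambda>\<sigma>. R (f \<sigma>) (g \<sigma>))"
proof -
  \<comment> \<open>\<open>definable_subst\<close> asks for a term at every index. The arguments are
    padded to a list, and \<open>min k 2\<close> sends all larger indices to its last entry.\<close>
  have "linear_term (\<lambda>\<sigma>. [f \<sigma>, g \<sigma>, 0] ! min k 2)" for k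
    using assms(2,3) linear_term_const[of 0]
    by (cases "k = 0"; cases "k = 1") (auto simp: min_def nth_Cons')
  from definable_subst[OF assms(1)[unfolded definable2_def], of "\<lambda>\<sigma> k. [f \<sigma>, g \<sigma>, 0] ! min k 2", OF this]
  show ?thesis by simp
qed

lemma definable3D:
  assumes "definable3 E R" "linear_term f" "linear_term g" "linear_term h"
  shows "definable E (\<lambda>\<sigma>. R (f \<sigma>) (g \<sigma>) (h \<sigma>))"
proof -
  have "linear_term (\<lambda>\<sigma>. [f \<sigma>, g \<sigma>, h \<sigma>] ! min k 2)" for k
    using assms(2-4)
    by (cases "k = 0"; cases "k = 1") (auto simp: min_def nth_Cons')
  from definable_subst[OF assms(1)[unfolded definable3_def], of "\<lambda>\<sigma> k. [f \<sigma>, g \<sigma>, h \<sigma>] ! min k 2", OF this]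
  show ?thesis by simp
qed

lemma definable1I: "definable E (\<lambda>\<sigma>. R (\<sigma> 0)) \<Longrightarrow> definable1 E R"
  by (simp add: definable1_def)

lemma definable2I: "definable E (\<lambda>\<sigma>. R (\<sigma> 0) (\<sigma> 1)) \<Longrightarrow> definable2 E R"
  by (simp add: definable2_def)

lemma definable3I: "definable E (\<lambda>\<sigma>. R (\<sigma> 0) (\<sigma> 1) (\<sigma> 2)) \<Longrightarrow> definable3 E R"
  by (simp add: definable3_def)

text \<open>Straddling is expressed by open intervals around \<open>x\<close> instead of distances,
  so that only the order and membership in \<open>E\<close> occur.\<close>

lemma frontier_definable: "definable1 E (\<lambda>x. x \<in> frontier E)"
proof -
  have *: "x \<in> frontier E \<longleftrightarrow> (\<forall>a b. a < x \<and> x < b \<longrightarrow>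
     (\<exists>y. y \<in> E \<and> a < y \<and> y < b) \<and> (\<exists>y. \<not> y \<in> E \<and> a < y \<and> y < b))" (is "_ = ?R") for x
  proof
    assume x: "x \<in> frontier E"
    show ?R
    proof (intro allI impI)
      fix a b assume ab: "a < x \<and> x < b"
      then obtain e where e: "e > 0" "ball x e \<subseteq> {a<..<b}"
        by (meson greaterThanLessThan_iff open_contains_ball open_greaterThanLessThan)
      then show "(\<exists>y. y \<in> E \<and> a < y \<and> y < b) \<and> (\<exists>y. \<not> y \<in> E \<and> a < y \<and> y < b)"
        using x unfolding frontier_straddle by (fastforce simp: subset_iff)
    qed
  next
    assume R: ?R
    show "x \<in> frontier E" unfolding frontier_straddle
    proof (intro CollectI allI impI)
      fix e :: real assume "e > 0"
      then have "x - e < x \<and> x < x + e" by simp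
      from R[rule_format, OF this]
      show "(\<exists>y\<in>E. dist x y < e) \<and> (\<exists>y. y \<notin> E \<and> dist x y < e)"
        by (auto simp: dist_real_def abs_less_iff) (metis add.commute diff_less_eq less_diff_eq neg_less_iff_less minus_diff_eq)+
    qed
  qed
  show ?thesis unfolding * by (intro definable1I definable_intros definable_mem)
qed

section \<open>Coding relations on a dense set of order type omega\<close>

lemma exists_above_finite_below:
  fixes x u :: real
  assumes "finite F" "x < u"
  obtains y where "x < y" "y < u" "\<And>j. j \<in> F \<Longrightarrow> j < u \<Longrightarrow> j < y"
proof -
  have fin: "finite (insert x {j \<in> F. j < u})" using assms(1) by simp
  define m where "m = Max (insert x {j \<in> F. j < u})"
  have "m < u" unfolding m_def using fin assms(2) by (subst Max_less_iff) auto
  then obtain y where y: "m < y" "y < u" using dense by blast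
  have "j \<le> m" if "j \<in> insert x {j \<in> F. j < u}" for j
    unfolding m_def using fin that by (rule Max_ge)
  with y show ?thesis by (intro that[of y]) force+
qed

text \<open>By \<open>lt_finite\<close> the order \<open>lt\<close> has type omega. In a sum
  \<open>p + \<theta> * z\<close> the summand \<open>p\<close> aims at a target and \<open>z\<close>
  is the message, recovered by \<open>\<theta>_inj\<close>. Since \<open>\<theta> < 1/2\<close>, the
  message shifts the sum by less than \<open>b/2\<close>, so every target interval within distance
  \<open>b/2\<close> of 0 is reached by some \<open>p\<close> in \<open>S\<close>.\<close>

locale omega_ordered_dense =
  fixes S :: "real set" and b :: real and lt :: "real \<Rightarrow> real \<Rightarrow> bool" and \<theta> :: real
  assumes S_bounded: "S \<subseteq> {-b<..<b}"
    and b_pos: "b > 0"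
    and S_dense: "\<And>x y. x < y \<Longrightarrow> -b \<le> x \<Longrightarrow> y \<le> b \<Longrightarrow> \<exists>s\<in>S. x < s \<and> s < y"
    and lt_irrefl: "\<And>x. \<not> lt x x"
    and lt_trans: "\<And>x y z. x \<in> S \<Longrightarrow> y \<in> S \<Longrightarrow> z \<in> S \<Longrightarrow> lt x y \<Longrightarrow> lt y z \<Longrightarrow> lt x z"
    and lt_total: "\<And>x y. x \<in> S \<Longrightarrow> y \<in> S \<Longrightarrow> x \<noteq> y \<Longrightarrow> lt x y \<or> lt y x"
    and lt_finite: "\<And>x. x \<in> S \<Longrightarrow> finite {y \<in> S. lt y x}"
    and \<theta>_pos: "0 < \<theta>" and \<theta>_less: "\<theta> < 1/2"
    and \<theta>_inj: "\<And>p p' z z'. p \<in> S \<Longrightarrow> p' \<in> S \<Longrightarrow> z \<in> S \<Longrightarrow> z' \<in> S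
                 \<Longrightarrow> p + \<theta> * z = p' + \<theta> * z' \<Longrightarrow> z = z'"
begin

definition le :: "real \<Rightarrow> real \<Rightarrow> bool" where
  "le x y \<longleftrightarrow> lt x y \<or> x = y"

text \<open>The points that, at their time of arrival in the enumeration of \<open>S\<close>, are the closest
  point above \<open>c\<close> so far.\<close>

definition right_record :: "real \<Rightarrow> real \<Rightarrow> bool" where
  "right_record c u \<longleftrightarrow> u \<in> S \<and> c < u \<and> (\<forall>j. j \<in> S \<and> lt j u \<and> c < j \<longrightarrow> u < j)"

definition val :: "real \<Rightarrow> real \<Rightarrow> real \<Rightarrow> bool" where
  "val e u z \<longleftrightarrow> z \<in> S \<and> le z u \<and> (\<exists>p. p \<in> S \<and> le p u \<and> e < p + \<theta> * z \<and>
     (\<forall>p' z'. p' \<in> S \<and> z' \<in> S \<and> le p' u \<and> le z' u \<and> e < p' + \<theta> * z' \<longrightarrow> p + \<theta> * z \<le> p' + \<theta> * z'))"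

definition code :: "real \<Rightarrow> real \<Rightarrow> real \<Rightarrow> real \<Rightarrow> real \<Rightarrow> bool" where
  "code c d e x y \<longleftrightarrow> (\<exists>u. right_record c u \<and> val d u x \<and> val e u y)"

lemma le_finite: "x \<in> S \<Longrightarrow> finite {y \<in> S. le y x}"
  using lt_finite[of x] by (auto simp: le_def conj_disj_distribL Collect_disj_eq)

lemma not_lt: "x \<in> S \<Longrightarrow> y \<in> S \<Longrightarrow> \<not> lt x y \<longleftrightarrow> le y x"
  using lt_total lt_trans lt_irrefl unfolding le_def by metis

text \<open>The number of predecessors, finite by \<open>lt_finite\<close>, is a rank into the
  natural numbers.\<close>

lemma lt_minimal:
  assumes "A \<subseteq> S" "A \<noteq> {}"
  obtains u where "u \<in> A" "\<And>j. j \<in> A \<Longrightarrow> \<not> lt j u"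
proof -
  define f where "f x = card {y \<in> S. lt y x}" for x
  obtain x where "x \<in> A" using assms(2) by blast
  then obtain u where u: "u \<in> A" "\<And>j. j \<in> A \<Longrightarrow> f u \<le> f j"
    using ex_has_least_nat[of "\<lambda>x. x \<in> A" x f] by blast
  have "\<not> lt j u" if j: "j \<in> A" for j
  proof
    assume ju: "lt j u"
    have "{y \<in> S. lt y j} \<subset> {y \<in> S. lt y u}"
      using j u(1) ju assms(1) lt_trans lt_irrefl by blast
    then have "f j < f u" unfolding f_def
      using lt_finite u(1) assms(1) by (intro psubset_card_mono) auto
    with u(2)[OF j] show False by simp
  qed
  with u(1) show ?thesis using that by blast
qed

lemma val_unique: "val e u z \<Longrightarrow> val e u z' \<Longrightarrow> z = z'"
  unfolding val_def by (metis \<theta>_inj order_antisym)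

lemma \<theta>_small: "z \<in> S \<Longrightarrow> \<bar>\<theta> * z\<bar> < b/2"
proof -
  assume "z \<in> S"
  then have "\<bar>z\<bar> < b" using S_bounded by (auto simp: abs_less_iff)
  then have "\<theta> * \<bar>z\<bar> < 1/2 * b"
    using \<theta>_pos \<theta>_less b_pos by (intro mult_strict_mono) auto
  then show ?thesis using \<theta>_pos by (simp add: abs_mult)
qed

lemma aim_exists:
  assumes "z \<in> S" "\<alpha> < \<beta>" "-b/2 \<le> \<alpha>" "\<beta> \<le> b/2"
  obtains p where "p \<in> S" "\<alpha> < p + \<theta> * z" "p + \<theta> * z < \<beta>"
proof -
  have "\<alpha> - \<theta> * z < \<beta> - \<theta> * z" "- b \<le> \<alpha> - \<theta> * z" "\<beta> - \<theta> * z \<le> b"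
    using \<theta>_small[OF assms(1)] assms(2-4) by linarith+
  from S_dense[OF this] show ?thesis using that by (auto simp: algebra_simps)
qed

text \<open>Only finitely many sums are available at \<open>u\<close>, so there is a gap directly
  below \<open>p + \<theta> * z\<close>, and every \<open>e\<close> in it has this sum as its least
  one above. A closed interval is returned so that later choices can be nested in it.\<close>

lemma aim_interval:
  assumes "z \<in> S" "p \<in> S" "u \<in> S" "le z u" "le p u" "\<alpha> < p + \<theta> * z"
  obtains \<alpha>' \<beta>' where "\<alpha> < \<alpha>'" "\<alpha>' < \<beta>'" "\<beta>' < p + \<theta> * z" "\<And>e. \<alpha>' \<le> e \<Longrightarrow> e \<le> \<beta>' \<Longrightarrow> val e u z"
proof -
  define V where "V = (\<lambda>(p, z). p + \<theta> * z) ` ({y \<in> S. le y u} \<times> {y \<in> S. le y u})"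
  have "finite V" unfolding V_def using le_finite[OF assms(3)] by simp
  then obtain y where y: "\<alpha> < y" "y < p + \<theta> * z" "\<And>j. j \<in> V \<Longrightarrow> j < p + \<theta> * z \<Longrightarrow> j < y"
    using exists_above_finite_below[OF _ assms(6)] by blast
  obtain \<beta>' where \<beta>': "y < \<beta>'" "\<beta>' < p + \<theta> * z" using dense[OF y(2)] by blast
  have "val e u z" if e: "y \<le> e" "e \<le> \<beta>'" for e
    unfolding val_def
  proof (intro conjI exI[of _ p] allI impI)
    show "e < p + \<theta> * z" using e \<beta>' by simp
    fix p' z' assume a: "p' \<in> S \<and> z' \<in> S \<and> le p' u \<and> le z' u \<and> e < p' + \<theta> * z'"
    then have "p' + \<theta> * z' \<in> V" unfolding V_def by force
    from y(3)[OF this] show "p + \<theta> * z \<le> p' + \<theta> * z'" using a e by linarith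
  qed (use assms in auto)
  then show ?thesis using that[of y \<beta>'] y \<beta>' by blast
qed

text \<open>A stage records the last point \<open>u\<close> admitted as a right record, a left bound \<open>l\<close> for \<open>c\<close>
  (so that \<open>l < c < u\<close>), and intervals for the parameters \<open>d\<close> and \<open>e\<close>.\<close>

definition stage :: "real \<Rightarrow> real \<Rightarrow> real \<times> real \<times> real \<times> real \<times> real \<times> real \<Rightarrow> bool" where
  "stage x y = (\<lambda>(l, u, \<alpha>, \<beta>, \<gamma>, \<delta>).
     u \<in> S \<and> -b \<le> l \<and> l < u \<and> (\<forall>j\<in>S. lt j u \<longrightarrow> l < j \<longrightarrow> u < j) \<and>
     -b/2 \<le> \<alpha> \<and> \<alpha> < \<beta> \<and> \<beta> \<le> b/2 \<and> -b/2 \<le> \<gamma> \<and> \<gamma> < \<delta> \<and> \<delta> \<le> b/2 \<and>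
     (\<forall>e. \<alpha> \<le> e \<longrightarrow> e \<le> \<beta> \<longrightarrow> val e u x) \<and> (\<forall>e. \<gamma> \<le> e \<longrightarrow> e \<le> \<delta> \<longrightarrow> val e u y))"

text \<open>First \<open>p\<close> and \<open>q\<close> are aimed into the given intervals. Then
  \<open>l'\<close> is put so close to \<open>r\<close> that none of the finitely many points to be
  avoided lies between, and \<open>u\<close> is the \<open>lt\<close>-least point of
  \<open>S\<close> between \<open>l'\<close> and \<open>r\<close>. So \<open>u\<close> comes after
  \<open>p\<close>, \<open>q\<close>, \<open>x\<close>, \<open>y\<close>, and no earlier point lies
  between \<open>l'\<close> and \<open>r\<close>.\<close>

lemma stage_extend:
  assumes xy: "x \<in> S" "y \<in> S" and M: "finite M" and lr: "-b \<le> l" "l < r" "r \<le> b"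
    and \<alpha>\<beta>: "-b/2 \<le> \<alpha>" "\<alpha> < \<beta>" "\<beta> \<le> b/2" and \<gamma>\<delta>: "-b/2 \<le> \<gamma>" "\<gamma> < \<delta>" "\<delta> \<le> b/2"
  shows "\<exists>l' u \<alpha>' \<beta>' \<gamma>' \<delta>'. stage x y (l', u, \<alpha>', \<beta>', \<gamma>', \<delta>') \<and>
    l < l' \<and> u < r \<and> u \<notin> M \<and> (\<forall>j\<in>S. lt j u \<longrightarrow> l' < j \<longrightarrow> r \<le> j) \<and>
    \<alpha> \<le> \<alpha>' \<and> \<beta>' \<le> \<beta> \<and> \<gamma> \<le> \<gamma>' \<and> \<delta>' \<le> \<delta>"
proof -
  obtain p where p: "p \<in> S" "\<alpha> < p + \<theta> * x" "p + \<theta> * x < \<beta>"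
    using aim_exists[OF xy(1) \<alpha>\<beta>(2,1,3)] by blast
  obtain q where q: "q \<in> S" "\<gamma> < q + \<theta> * y" "q + \<theta> * y < \<delta>"
    using aim_exists[OF xy(2) \<gamma>\<delta>(2,1,3)] by blast
  define F where "F = M \<union> (\<Union>t\<in>{p, q, x, y}. {j \<in> S. le j t})"
  have "finite F" unfolding F_def using M p q xy le_finite by auto
  then obtain l' where l': "l < l'" "l' < r" "\<And>j. j \<in> F \<Longrightarrow> j < r \<Longrightarrow> j < l'"
    using exists_above_finite_below[OF _ lr(2)] by blast
  define A where "A = {s \<in> S. l' < s \<and> s < r}"
  have "A \<subseteq> S" "A \<noteq> {}"
    unfolding A_def using S_dense[OF l'(2)] l'(1) lr by auto
  then obtain u where uA: "u \<in> A" and min: "\<And>j. j \<in> A \<Longrightarrow> \<not> lt j u"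
    using lt_minimal by metis
  then have u: "u \<in> S" "l' < u" "u < r" by (auto simp: A_def)
  have uF: "u \<notin> F" using l'(3) u by force
  have le: "le t u" if "t \<in> {p, q, x, y}" for t
  proof -
    have "t \<in> S" using that p q xy by auto
    moreover have "\<not> le u t" using uF that u(1) unfolding F_def by blast
    ultimately show ?thesis using not_lt[of u t] u(1) unfolding le_def using lt_total by blast
  qed
  obtain \<alpha>' \<beta>' where 1: "\<alpha> < \<alpha>'" "\<alpha>' < \<beta>'" "\<beta>' < p + \<theta> * x" "\<And>e. \<alpha>' \<le> e \<Longrightarrow> e \<le> \<beta>' \<Longrightarrow> val e u x"
    using aim_interval[OF xy(1) p(1) u(1) _ _ p(2)] le by blast
  obtain \<gamma>' \<delta>' where 2: "\<gamma> < \<gamma>'" "\<gamma>' < \<delta>'" "\<delta>' < q + \<theta> * y" "\<And>e. \<gamma>' \<le> e \<Longrightarrow> e \<le> \<delta>' \<Longrightarrow> val e u y"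
    using aim_interval[OF xy(2) q(1) u(1) _ _ q(2)] le by blast
  have far: "r \<le> j" if "j \<in> S" "lt j u" "l' < j" for j using min[of j] that unfolding A_def by force
  have "stage x y (l', u, \<alpha>', \<beta>', \<gamma>', \<delta>')"
  proof -
    have "-b \<le> l'" "-b/2 \<le> \<alpha>'" "\<beta>' \<le> b/2" "-b/2 \<le> \<gamma>'" "\<delta>' \<le> b/2"
      using lr(1) l'(1) \<alpha>\<beta> \<gamma>\<delta> p(3) q(3) 1(1,3) 2(1,3) by linarith+
    moreover have "\<forall>j\<in>S. lt j u \<longrightarrow> l' < j \<longrightarrow> u < j"
      using far u(3) less_le_trans by blast
    ultimately show ?thesis
      unfolding stage_def prod.case using u(1,2) 1(2,4) 2(2,4) by blast
  qed
  moreover have "u \<notin> M" using uF by (simp add: F_def)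
  moreover have "\<beta>' \<le> \<beta>" "\<delta>' \<le> \<delta>" using 1 2 p q by auto
  ultimately show ?thesis
    using far l'(1) u(3) less_imp_le[OF 1(1)] less_imp_le[OF 2(1)] by blast
qed

text \<open>Infinitely many nested stages are built, stage \<open>n\<close> writing the pair
  \<open>(f n, g n)\<close> at the record \<open>u n\<close>. The parameters \<open>c\<close>,
  \<open>d\<close>, \<open>e\<close> are common points of the nested intervals.\<close>

lemma code_sequence:
  assumes f: "\<And>n. f n \<in> S" and g: "\<And>n. g n \<in> S"
  shows "\<exists>c d e. \<forall>x y. code c d e x y \<longleftrightarrow> (\<exists>n::nat. x = f n \<and> y = g n)"
proof -
  \<comment> \<open>The clause on \<open>j\<close> says that no point arriving before the new
    \<open>u'\<close> lies between \<open>l'\<close> and the old \<open>u\<close>; it excludes extra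
    records between two stages.\<close>
  define next_stage where "next_stage = (\<lambda>(l, u, \<alpha>, \<beta>, \<gamma>, \<delta>) (l'::real, u', \<alpha>'::real, \<beta>'::real, \<gamma>'::real, \<delta>'::real).
    l < l' \<and> u' < u \<and> lt u u' \<and> (\<forall>j\<in>S. lt j u' \<longrightarrow> l' < j \<longrightarrow> u \<le> j) \<and>
    \<alpha> \<le> \<alpha>' \<and> \<beta>' \<le> \<beta> \<and> \<gamma> \<le> \<gamma>' \<and> \<delta>' \<le> (\<delta>::real))"
  \<comment> \<open>This excludes records before the one of stage 0.\<close>
  define first where "first = (\<lambda>(l::real, u, \<alpha>::real, \<beta>::real, \<gamma>::real, \<delta>::real). \<forall>j\<in>S. lt j u \<longrightarrow> \<not> l < j)"
  have "\<exists>st. \<forall>n. (stage (f n) (g n) (st n) \<and> (n = 0 \<longrightarrow> first (st n))) \<and> next_stage (st n) (st (Suc n))"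
  proof (rule dependent_nat_choice)
    have prems: "-b \<le> -b" "-b < b" "b \<le> b" "-b/2 \<le> -b/2" "-b/2 < b/2" "b/2 \<le> b/2"
      using b_pos by auto
    obtain l' u \<alpha>' \<beta>' \<gamma>' \<delta>' where st: "stage (f 0) (g 0) (l', u, \<alpha>', \<beta>', \<gamma>', \<delta>')"
      and far: "\<And>j. j \<in> S \<Longrightarrow> lt j u \<Longrightarrow> l' < j \<Longrightarrow> b \<le> j"
      using stage_extend[OF f[of 0] g[of 0] finite.emptyI prems prems(4-6)] by blast
    then show "\<exists>s. stage (f 0) (g 0) s \<and> (0 = 0 \<longrightarrow> first s)"
      using S_bounded unfolding first_def by (intro exI[of _ "(l', u, \<alpha>', \<beta>', \<gamma>', \<delta>')"]) force
  next
    fix s n assume s: "stage (f n) (g n) s \<and> (n = 0 \<longrightarrow> first s)"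
    obtain l u \<alpha> \<beta> \<gamma> \<delta> where s_eq: "s = (l, u, \<alpha>, \<beta>, \<gamma>, \<delta>)" by (cases s) auto
    have st: "u \<in> S" "-b \<le> l" "l < u" "-b/2 \<le> \<alpha>" "\<alpha> < \<beta>" "\<beta> \<le> b/2" "-b/2 \<le> \<gamma>" "\<gamma> < \<delta>" "\<delta> \<le> b/2"
      using s unfolding s_eq stage_def by auto
    have ub: "u \<le> b" using st(1) S_bounded by force
    obtain l' u' \<alpha>' \<beta>' \<gamma>' \<delta>' where st': "stage (f (Suc n)) (g (Suc n)) (l', u', \<alpha>', \<beta>', \<gamma>', \<delta>')"
      "l < l'" "u' < u" "u' \<notin> {j \<in> S. le j u}" "\<And>j. j \<in> S \<Longrightarrow> lt j u' \<Longrightarrow> l' < j \<Longrightarrow> u \<le> j"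
      "\<alpha> \<le> \<alpha>'" "\<beta>' \<le> \<beta>" "\<gamma> \<le> \<gamma>'" "\<delta>' \<le> \<delta>"
      using stage_extend[OF f[of "Suc n"] g[of "Suc n"] le_finite[OF st(1)] st(2,3) ub st(4-9)] by blast
    have "u' \<in> S" using st'(1) by (simp add: stage_def)
    then have "lt u u'" using st'(4) lt_total[of u u'] st(1) by (auto simp: le_def)
    then show "\<exists>t. (stage (f (Suc n)) (g (Suc n)) t \<and> (Suc n = 0 \<longrightarrow> first t)) \<and> next_stage s t"
      using st' unfolding s_eq next_stage_def
      by (intro exI[of _ "(l', u', \<alpha>', \<beta>', \<gamma>', \<delta>')"]) auto
  qed
  then obtain st where st: "\<And>n. stage (f n) (g n) (st n)" "first (st 0)" "\<And>n. next_stage (st n) (st (Suc n))"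
    by blast
  define l where "l n = fst (st n)" for n
  define u where "u n = fst (snd (st n))" for n
  define \<alpha> where "\<alpha> n = fst (snd (snd (st n)))" for n
  define \<beta> where "\<beta> n = fst (snd (snd (snd (st n))))" for n
  define \<gamma> where "\<gamma> n = fst (snd (snd (snd (snd (st n)))))" for n
  define \<delta> where "\<delta> n = snd (snd (snd (snd (snd (st n)))))" for n
  have st_eq: "st n = (l n, u n, \<alpha> n, \<beta> n, \<gamma> n, \<delta> n)" for n
    by (simp add: l_def u_def \<alpha>_def \<beta>_def \<gamma>_def \<delta>_def)
  note stn = st(1)[unfolded st_eq stage_def, simplified]
  note nxt = st(3)[unfolded st_eq next_stage_def, simplified]
  note fst0 = st(2)[unfolded st_eq first_def, simplified]
  \<comment> \<open>Nested closed intervals have a common point.\<close>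
  have common: "\<exists>c. \<forall>n::nat. p n \<le> c \<and> c \<le> q n"
    if "\<And>n. p n \<le> q n" "\<And>n. p n \<le> p (Suc n)" "\<And>n. q (Suc n) \<le> q n" for p q :: "nat \<Rightarrow> real"
  proof -
    have pq: "p m \<le> q n" for m n
      using lift_Suc_mono_le[of p, OF that(2), of m "max m n"]
        lift_Suc_antimono_le[of q, OF that(3), of n "max m n"] that(1)[of "max m n"] by simp
    then have bdd: "bdd_above (range p)" by (auto simp: bdd_above_def)
    show ?thesis
      by (rule exI[of _ "SUP n. p n"]) (auto intro: cSUP_upper[OF _ bdd] cSUP_least pq)
  qed
  obtain c where c: "\<And>n. l n \<le> c" "\<And>n. c \<le> u n"
    using common[of l u] stn nxt by (metis less_imp_le)
  obtain d where d: "\<And>n. \<alpha> n \<le> d" "\<And>n. d \<le> \<beta> n"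
    using common[of \<alpha> \<beta>] stn nxt by (metis less_imp_le)
  obtain e where e: "\<And>n. \<gamma> n \<le> e" "\<And>n. e \<le> \<delta> n"
    using common[of \<gamma> \<delta>] stn nxt by (metis less_imp_le)
  \<comment> \<open>Strictness comes from the next stage, whose bounds lie strictly inside.\<close>
  have cl: "l n < c" and cu: "c < u n" for n
    using c[of "Suc n"] nxt[of n] by force+
  have lt_u: "lt (u m) (u n)" if "m < n" for m n
    using that
  proof (induction n)
    case (Suc n)
    then show ?case using nxt[of n] stn lt_trans[of "u m" "u n" "u (Suc n)"] by (cases "m = n") auto
  qed simp
  have inj_u: "inj u" using lt_u lt_irrefl by (metis injI linorder_neqE_nat)
  \<comment> \<open>For a record \<open>w\<close>, take the first \<open>n\<close> such that
    \<open>u n\<close> does not precede \<open>w\<close>. If \<open>w\<close> differs from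
    \<open>u n\<close>, it arrives between stages \<open>n - 1\<close> and \<open>n\<close>; being a
    record it lies below \<open>u (n - 1)\<close>, while the clause of \<open>next_stage\<close>
    puts it at or above. For \<open>n = 0\<close> the predicate \<open>first\<close>
    applies.\<close>
  have rec: "right_record c w \<longleftrightarrow> (\<exists>n. w = u n)" for w
  proof
    assume w: "right_record c w"
    then have wS: "w \<in> S" "c < w" by (auto simp: right_record_def)
    have "\<exists>n. \<not> lt (u n) w"
    proof (rule ccontr)
      assume "\<nexists>n. \<not> lt (u n) w"
      then have "range u \<subseteq> {y \<in> S. lt y w}" using stn by blast
      then have "finite (range u)" using lt_finite[OF wS(1)] finite_subset by blast
      then show False using inj_u finite_imageD infinite_UNIV_nat by blast
    qed
    then obtain n where n: "\<not> lt (u n) w" "\<And>m. m < n \<Longrightarrow> lt (u m) w"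
      using exists_least_iff[of "\<lambda>n. \<not> lt (u n) w"] by blast
    show "\<exists>n. w = u n"
    proof (rule ccontr)
      assume "\<nexists>n. w = u n"
      then have wn: "lt w (u n)" using n(1) lt_total[of w "u n"] wS stn by blast
      have lw: "l n < w" using cl[of n] wS by simp
      show False
      proof (cases n)
        case 0
        then show False using fst0 wn lw wS by blast
      next
        case (Suc m)
        then have "u m \<le> w" using nxt[of m] wn lw wS by blast
        moreover have "w < u m"
          using w n(2)[of m] Suc cu[of m] stn[of m] by (auto simp: right_record_def)
        ultimately show False by simp
      qed
    qed
  next
    assume "\<exists>n. w = u n"
    then show "right_record c w" using stn cu cl unfolding right_record_def by (metis less_trans)
  qed
  have vals: "val d (u n) (f n)" "val e (u n) (g n)" for n
    using stn[of n] d e by auto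
  have "code c d e x y \<longleftrightarrow> (\<exists>n. x = f n \<and> y = g n)" for x y
    unfolding code_def rec using vals val_unique by metis
  then show ?thesis by blast
qed

lemma S_countable: "countable S"
proof (cases "S = {}")
  case False
  define f where "f x = card {y \<in> S. lt y x}" for x
  have "inj_on f S"
  proof (rule inj_onI, rule ccontr)
    have *: "f x < f y" if "x \<in> S" "y \<in> S" "lt x y" for x y
    proof -
      have "{z \<in> S. lt z x} \<subset> {z \<in> S. lt z y}" using that lt_trans lt_irrefl by blast
      then show ?thesis unfolding f_def using lt_finite that by (intro psubset_card_mono) auto
    qed
    fix x y assume "x \<in> S" "y \<in> S" "f x = f y" "x \<noteq> y"
    then show False using lt_total[of x y] *[of x y] *[of y x] by auto
  qed
  then show ?thesis by (rule countableI)
qed simp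

text \<open>A nonempty relation on the countable set \<open>S\<close> is the range of a sequence of
  pairs.\<close>

lemma code_relation:
  assumes "R \<subseteq> S \<times> S"
  shows "\<exists>c d e. \<forall>x y. code c d e x y \<longleftrightarrow> (x, y) \<in> R"
proof (cases "R = {}")
  case True
  \<comment> \<open>No point of \<open>S\<close> lies above \<open>b\<close>, so
    \<open>c = b\<close> has no records and codes the empty relation.\<close>
  have "\<not> code b d e x y" for d e x y
    using S_bounded unfolding code_def right_record_def by force
  then show ?thesis using True by blast
next
  case False
  have "countable R" using assms S_countable countable_SIGMA[of S "\<lambda>_. S"] countable_subset by blast
  then obtain h :: "nat \<Rightarrow> real \<times> real" where h: "R = range h" using False uncountable_def by blast
  have "fst (h n) \<in> S" "snd (h n) \<in> S" for n
  proof -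
    have "h n \<in> S \<times> S" using h assms by blast
    then show "fst (h n) \<in> S" "snd (h n) \<in> S" by auto
  qed
  from code_sequence[of "\<lambda>n. fst (h n)" "\<lambda>n. snd (h n)", OF this]
  obtain c d e where cde: "\<And>x y. code c d e x y \<longleftrightarrow> (\<exists>n. x = fst (h n) \<and> y = snd (h n))" by blast
  have "(\<exists>n. x = fst (h n) \<and> y = snd (h n)) \<longleftrightarrow> (x, y) \<in> R" for x y
    unfolding h image_iff by (metis UNIV_I prod.collapse fst_conv snd_conv)
  with cde show ?thesis by blast
qed

end

section \<open>A normal form for Borel sets\<close>

datatype 'i literal = Below 'i real | Above 'i real | Member nat | Nonmember nat

primrec holds :: "real ^ 'i \<Rightarrow> nat set \<Rightarrow> 'i literal \<Rightarrow> bool" where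
  "holds x Y (Below i z) \<longleftrightarrow> x $ i < z"
| "holds x Y (Above i z) \<longleftrightarrow> z < x $ i"
| "holds x Y (Member k) \<longleftrightarrow> k \<in> Y"
| "holds x Y (Nonmember k) \<longleftrightarrow> k \<notin> Y"

primrec threshold_in :: "real set \<Rightarrow> 'i literal \<Rightarrow> bool" where
  "threshold_in T (Below i z) \<longleftrightarrow> z \<in> T"
| "threshold_in T (Above i z) \<longleftrightarrow> z \<in> T"
| "threshold_in T (Member k) \<longleftrightarrow> True"
| "threshold_in T (Nonmember k) \<longleftrightarrow> True"

definition open_cube :: "real \<Rightarrow> (real ^ 'i) set" where
  "open_cube b = {x. \<forall>i. -b < x $ i \<and> x $ i < b}"

text \<open>A countable conjunction of countable disjunctions of literals, with one existential
  set quantifier in front: a normal form for analytic sets.\<close>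

definition clausal :: "real set \<Rightarrow> real \<Rightarrow> (real ^ 'i) set \<Rightarrow> bool" where
  "clausal T b X \<longleftrightarrow> (\<exists>L :: nat \<Rightarrow> 'i literal set. (\<forall>n. \<forall>l\<in>L n. threshold_in T l) \<and>
     X = {x \<in> open_cube b. \<exists>Y. \<forall>n. \<exists>l\<in>L n. holds x Y l})"

text \<open>The pairing function splits one set \<open>Y\<close> into countably many sections; the
  shifted literal speaks of section \<open>m\<close>. Thus a single set quantifier can serve
  countably many sets.\<close>

primrec shift_literal :: "nat \<Rightarrow> 'i literal \<Rightarrow> 'i literal" where
  "shift_literal m (Below i z) = Below i z"
| "shift_literal m (Above i z) = Above i z"
| "shift_literal m (Member k) = Member (prod_encode (m, k))"
| "shift_literal m (Nonmember k) = Nonmember (prod_encode (m, k))"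

lemma holds_shift: "holds x Y (shift_literal m l) = holds x {k. prod_encode (m, k) \<in> Y} l"
  by (cases l) auto

lemma threshold_shift: "threshold_in T (shift_literal m l) = threshold_in T l"
  by (cases l) auto

lemma clausal_iff:
  "clausal T b X \<longleftrightarrow> (\<exists>L. (\<forall>n. \<forall>l\<in>L n. threshold_in T l) \<and>
     (\<forall>x. x \<in> X \<longleftrightarrow> x \<in> open_cube b \<and> (\<exists>Y. \<forall>n::nat. \<exists>l\<in>L n. holds x Y l)))"
  by (simp add: clausal_def set_eq_iff)

lemma clausalI:
  fixes L :: "nat \<Rightarrow> 'i::finite literal set"
  assumes "\<And>n l. l \<in> L n \<Longrightarrow> threshold_in T l"
    "\<And>x. x \<in> X \<longleftrightarrow> x \<in> open_cube b \<and> (\<exists>Y. \<forall>n. \<exists>l\<in>L n. holds x Y l)"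
  shows "clausal T b X"
  unfolding clausal_iff by (intro exI[of _ L]) (simp add: assms)

text \<open>The witnesses of all the \<open>X m\<close> are merged into one set with these as its
  sections, and the clauses are numbered by pairs.\<close>

lemma clausal_Inter:
  fixes X :: "nat \<Rightarrow> (real ^ 'i) set"
  assumes "\<And>m. clausal T b (X m)"
  shows "clausal T b (\<Inter>m. X m)"
proof -
  from assms have "\<forall>m. \<exists>L. (\<forall>n. \<forall>l\<in>L n. threshold_in T l) \<and>
     (\<forall>x. x \<in> X m \<longleftrightarrow> x \<in> open_cube b \<and> (\<exists>Y. \<forall>n::nat. \<exists>l\<in>L n. holds x Y l))"
    by (simp add: clausal_iff)
  from choice[OF this] obtain L where "\<forall>m. (\<forall>n. \<forall>l\<in>L m n. threshold_in T l) \<and>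
     (\<forall>x. x \<in> X m \<longleftrightarrow> x \<in> open_cube b \<and> (\<exists>Y. \<forall>n::nat. \<exists>l\<in>L m n. holds x Y l))" ..
  then have L: "\<And>m n l. l \<in> L m n \<Longrightarrow> threshold_in T l"
    "\<And>m x. x \<in> X m \<longleftrightarrow> x \<in> open_cube b \<and> (\<exists>Y. \<forall>n. \<exists>l\<in>L m n. holds x Y l)"
    by simp_all
  define L' where "L' k = (case prod_decode k of (m, n) \<Rightarrow> shift_literal m ` L m n)" for k
  show ?thesis
  proof (rule clausalI[of L'])
    show "threshold_in T l" if "l \<in> L' n" for n l
      using that L(1) unfolding L'_def by (auto simp: threshold_shift split: prod.splits)
    fix x
    have "(\<exists>Y. \<forall>k. \<exists>l\<in>L' k. holds x Y l) \<longleftrightarrow> (\<exists>Y. \<forall>m n. \<exists>l\<in>L m n. holds x {k. prod_encode (m, k) \<in> Y} l)"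
      (is "?A \<longleftrightarrow> ?B")
    proof -
      have "(\<forall>k. \<exists>l\<in>L' k. holds x Y l) \<longleftrightarrow> (\<forall>m n. \<exists>l\<in>L' (prod_encode (m, n)). holds x Y l)" for Y
        by (metis prod_decode_inverse surj_pair)
      then show ?thesis by (simp add: L'_def holds_shift)
    qed
    also have "\<dots> \<longleftrightarrow> (\<forall>m. \<exists>Y. \<forall>n. \<exists>l\<in>L m n. holds x Y l)"
    proof
      assume "\<forall>m. \<exists>Y. \<forall>n. \<exists>l\<in>L m n. holds x Y l"
      then obtain Y where Y: "\<And>m n. \<exists>l\<in>L m n. holds x (Y m) l" by metis
      define Z where "Z = {j. case prod_decode j of (m, k) \<Rightarrow> k \<in> Y m}"
      have "{k. prod_encode (m, k) \<in> Z} = Y m" for m by (simp add: Z_def)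
      then show "\<exists>Y. \<forall>m n. \<exists>l\<in>L m n. holds x {k. prod_encode (m, k) \<in> Y} l"
        using Y by (intro exI[of _ Z]) simp
    qed blast
    finally show "x \<in> (\<Inter>m. X m) \<longleftrightarrow> x \<in> open_cube b \<and> (\<exists>Y. \<forall>n. \<exists>l\<in>L' n. holds x Y l)"
      using L(2) by auto
  qed
qed

lemma clausal_Union:
  fixes X :: "nat \<Rightarrow> (real ^ 'i) set"
  assumes "\<And>m. clausal T b (X m)"
  shows "clausal T b (\<Union>m. X m)"
proof -
  from assms have "\<forall>m. \<exists>L. (\<forall>n. \<forall>l\<in>L n. threshold_in T l) \<and>
     (\<forall>x. x \<in> X m \<longleftrightarrow> x \<in> open_cube b \<and> (\<exists>Y. \<forall>n::nat. \<exists>l\<in>L n. holds x Y l))"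
    by (simp add: clausal_iff)
  from choice[OF this] obtain L where "\<forall>m. (\<forall>n. \<forall>l\<in>L m n. threshold_in T l) \<and>
     (\<forall>x. x \<in> X m \<longleftrightarrow> x \<in> open_cube b \<and> (\<exists>Y. \<forall>n::nat. \<exists>l\<in>L m n. holds x Y l))" ..
  then have L: "\<And>m n l. l \<in> L m n \<Longrightarrow> threshold_in T l"
    "\<And>m x. x \<in> X m \<longleftrightarrow> x \<in> open_cube b \<and> (\<exists>Y. \<forall>n. \<exists>l\<in>L m n. holds x Y l)"
    by simp_all
  \<comment> \<open>Clause 0 says that some index is marked. The other clauses read: if
    \<open>m\<close> is marked, then clause \<open>n\<close> of \<open>X m\<close> holds in section
    \<open>Suc m\<close>.\<close>
  define L' where "L' j = (case j of 0 \<Rightarrow> range (\<lambda>m. Member (prod_encode (0, m)))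
     | Suc k \<Rightarrow> (case prod_decode k of (m, n) \<Rightarrow>
         insert (Nonmember (prod_encode (0, m))) (shift_literal (Suc m) ` L m n)))" for j
  show ?thesis
  proof (rule clausalI[of L'])
    show "threshold_in T l" if "l \<in> L' n" for n l
      using that L(1) unfolding L'_def by (auto simp: threshold_shift split: prod.splits nat.splits)
    fix x
    have "(\<exists>Y. \<forall>k. \<exists>l\<in>L' k. holds x Y l) \<longleftrightarrow> (\<exists>Y. (\<exists>m. prod_encode (0, m) \<in> Y) \<and>
       (\<forall>m n. prod_encode (0, m) \<in> Y \<longrightarrow> (\<exists>l\<in>L m n. holds x {k. prod_encode (Suc m, k) \<in> Y} l)))"
    proof -
      have *: "(\<forall>k. \<exists>l\<in>L' k. holds x Y l) \<longleftrightarrow>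
        (\<exists>l\<in>L' 0. holds x Y l) \<and> (\<forall>m n. \<exists>l\<in>L' (Suc (prod_encode (m, n))). holds x Y l)" for Y
        by (metis not0_implies_Suc prod_decode_inverse surj_pair)
      show ?thesis unfolding * by (simp add: L'_def holds_shift disj_imp)
    qed
    also have "\<dots> \<longleftrightarrow> (\<exists>m. \<exists>Y. \<forall>n. \<exists>l\<in>L m n. holds x Y l)"
    proof
      assume "\<exists>m. \<exists>Y. \<forall>n. \<exists>l\<in>L m n. holds x Y l"
      then obtain m Y where Y: "\<And>n. \<exists>l\<in>L m n. holds x Y l" by metis
      define Z where "Z = insert (prod_encode (0, m)) ((\<lambda>k. prod_encode (Suc m, k)) ` Y)"
      have "{k. prod_encode (Suc m, k) \<in> Z} = Y" by (auto simp: Z_def)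
      moreover have "prod_encode (0, j) \<in> Z \<longleftrightarrow> j = m" for j by (auto simp: Z_def)
      ultimately show "\<exists>Y. (\<exists>m. prod_encode (0, m) \<in> Y) \<and>
       (\<forall>m n. prod_encode (0, m) \<in> Y \<longrightarrow> (\<exists>l\<in>L m n. holds x {k. prod_encode (Suc m, k) \<in> Y} l))"
        using Y by (intro exI[of _ Z]) simp
    qed blast
    finally show "x \<in> (\<Union>m. X m) \<longleftrightarrow> x \<in> open_cube b \<and> (\<exists>Y. \<forall>n. \<exists>l\<in>L' n. holds x Y l)"
      using L(2) by auto
  qed
qed

lemma clausal_less:
  fixes i :: "'i::finite"
  assumes dense: "\<And>x y. x < y \<Longrightarrow> -b \<le> x \<Longrightarrow> y \<le> b \<Longrightarrow> \<exists>s\<in>T. x < s \<and> s < y"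
  shows "clausal T b {x \<in> open_cube b. x $ i < r}"
proof (rule clausalI[of "\<lambda>n. {Below i z | z. z \<in> T \<and> z \<le> r}"])
  fix x :: "real ^ 'i"
  have "\<exists>z\<in>T. z \<le> r \<and> x $ i < z" if "x \<in> open_cube b" "x $ i < r"
  proof -
    \<comment> \<open>Density of \<open>T\<close> is available only between \<open>-b\<close> and
      \<open>b\<close>, hence the truncation of \<open>r\<close>.\<close>
    have "x $ i < min r b" "-b \<le> x $ i" "min r b \<le> b"
      using that by (auto simp: open_cube_def less_imp_le)
    then show ?thesis using dense[of "x $ i" "min r b"] by (meson less_imp_le min_less_iff_conj)
  qed
  then show "x \<in> {x \<in> open_cube b. x $ i < r} \<longleftrightarrow> x \<in> open_cube b \<and>
    (\<exists>Y. \<forall>n::nat. \<exists>l\<in>{Below i z | z. z \<in> T \<and> z \<le> r}. holds x Y l)" by force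
qed auto

text \<open>The weak inequality is the conjunction over \<open>n\<close> of the strict inequalities
  with bound \<open>r - 1 / real (Suc n)\<close>, each a disjunction over thresholds.\<close>

lemma clausal_ge:
  fixes i :: "'i::finite"
  assumes dense: "\<And>x y. x < y \<Longrightarrow> -b \<le> x \<Longrightarrow> y \<le> b \<Longrightarrow> \<exists>s\<in>T. x < s \<and> s < y"
  shows "clausal T b {x \<in> open_cube b. r \<le> x $ i}"
proof (rule clausalI[of "\<lambda>n. {Above i z | z. z \<in> T \<and> r - 1 / real (Suc n) < z}"])
  fix x :: "real ^ 'i"
  have "\<exists>z\<in>T. r - 1 / real (Suc n) < z \<and> z < x $ i" if "x \<in> open_cube b" "r \<le> x $ i" for n
  proof -
    have "r - 1 / real (Suc n) < x $ i"
      using that(2) by (smt (verit) of_nat_0_less_iff zero_less_Suc zero_less_divide_1_iff)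
    then have "max (-b) (r - 1 / real (Suc n)) < x $ i" using that(1) by (auto simp: open_cube_def)
    moreover have "x $ i \<le> b" using that(1) by (auto simp: open_cube_def less_imp_le)
    ultimately show ?thesis using dense[of "max (-b) (r - 1 / real (Suc n))" "x $ i"] by auto
  qed
  moreover have "r \<le> x $ i" if "\<And>n. \<exists>z\<in>T. r - 1 / real (Suc n) < z \<and> z < x $ i"
  proof (rule ccontr)
    assume "\<not> r \<le> x $ i"
    then obtain n where "inverse (real (Suc n)) < r - x $ i"
      using reals_Archimedean[of "r - x $ i"] by auto
    then show False using that[of n] by (auto simp: inverse_eq_divide)
  qed
  ultimately show "x \<in> {x \<in> open_cube b. r \<le> x $ i} \<longleftrightarrow> x \<in> open_cube b \<and>
    (\<exists>Y. \<forall>n::nat. \<exists>l\<in>{Above i z | z. z \<in> T \<and> r - 1 / real (Suc n) < z}. holds x Y l)" by force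
qed auto

text \<open>The normal form is not visibly closed under complements, so the induction over the
  sigma-algebra carries a set and its complement together; complements then swap the two claims and
  unions become intersections.\<close>

lemma clausal_borel:
  fixes X :: "(real ^ 'i) set"
  assumes dense: "\<And>x y. x < y \<Longrightarrow> -b \<le> x \<Longrightarrow> y \<le> b \<Longrightarrow> \<exists>s\<in>T. x < s \<and> s < y"
    and X: "X \<in> sets borel"
  shows "clausal T b (open_cube b \<inter> X)"
proof -
  have "X \<in> sigma_sets UNIV ((\<lambda>(a, i). {x::real^'i. x \<bullet> i < a}) ` (UNIV \<times> Basis))"
    using X by (subst (asm) borel_eq_halfspace_less) simp
  then have "clausal T b (open_cube b \<inter> X) \<and> clausal T b (open_cube b - X)"
  proof (induction rule: sigma_sets.induct)
    case (Basic A)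
    then obtain a i where A: "A = {x. x $ i < a}"
      by (auto simp: Basis_vec_def inner_axis)
    have "open_cube b \<inter> A = {x \<in> open_cube b. x $ i < a}" "open_cube b - A = {x \<in> open_cube b. a \<le> x $ i}"
      by (auto simp: A)
    then show ?case using clausal_less[OF dense, where b = b and r = a and i = i]
        clausal_ge[OF dense, where b = b and r = a and i = i] by simp
  next
    case Empty
    have "clausal T b ({} :: (real ^ 'i) set)"
      by (rule clausalI[of "\<lambda>_. {}"]) auto
    moreover have "clausal T b (open_cube b :: (real ^ 'i) set)"
      by (rule clausalI[of "\<lambda>_. {Member 0}"]) auto
    ultimately show ?case by simp
  next
    case (Compl A)
    have "open_cube b \<inter> (UNIV - A) = open_cube b - A" "open_cube b - (UNIV - A) = open_cube b \<inter> A" by auto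
    then show ?case using Compl.IH by simp
  next
    case (Union A)
    have "open_cube b \<inter> (\<Union>n. A n) = (\<Union>n. open_cube b \<inter> A n)"
      "open_cube b - (\<Union>n. A n) = (\<Inter>n. open_cube b - A n)" by auto
    then show ?case
      using clausal_Union[of T b "\<lambda>n. open_cube b \<inter> A n"] clausal_Inter[of T b "\<lambda>n. open_cube b - A n"] Union.IH
      by simp
  qed
  then show ?thesis by blast
qed

section \<open>From Borel sets to formulas\<close>

context omega_ordered_dense
begin

lemma S_infinite: "infinite S"
proof
  assume "finite S"
  moreover obtain s where "s \<in> S" using S_dense[of "-b" b] b_pos by auto
  ultimately have "Max S \<in> S" "\<And>x. x \<in> S \<Longrightarrow> x \<le> Max S" using Max_in[of S] by fastforce+
  moreover obtain t where "t \<in> S" "Max S < t" using S_dense[of "Max S" b] calculation S_bounded by force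
  ultimately show False by force
qed

context
  fixes E :: "real set"
  assumes S_definable: "definable1 E (\<lambda>x. x \<in> S)" and lt_definable: "definable2 E lt"
begin

lemma right_record_definable: "definable2 E right_record"
  by (rule definable2I) (unfold right_record_def,
    intro definable_intros definable1D[OF S_definable] definable2D[OF lt_definable])

lemma val_definable: "definable3 E val"
  by (rule definable3I) (unfold val_def le_def,
    intro definable_intros definable1D[OF S_definable] definable2D[OF lt_definable])

lemma code_definable:
  assumes "linear_term f1" "linear_term f2" "linear_term f3" "linear_term f4" "linear_term f5"
  shows "definable E (\<lambda>\<sigma>. code (f1 \<sigma>) (f2 \<sigma>) (f3 \<sigma>) (f4 \<sigma>) (f5 \<sigma>))"
proof -
  have *: "definable E (\<lambda>\<sigma>. code (\<sigma> 0) (\<sigma> 1) (\<sigma> 2) (\<sigma> 3) (\<sigma> 4))"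
    unfolding code_def
    by (intro definable_intros definable2D[OF right_record_definable] definable3D[OF val_definable])
  have "linear_term (\<lambda>\<sigma>. [f1 \<sigma>, f2 \<sigma>, f3 \<sigma>, f4 \<sigma>, f5 \<sigma>] ! min k 4)" for k
  proof -
    have "min k 4 \<in> {0, 1, 2, 3, 4}" by auto
    then show ?thesis using assms by auto
  qed
  from definable_subst[OF *, of "\<lambda>\<sigma> k. [f1 \<sigma>, f2 \<sigma>, f3 \<sigma>, f4 \<sigma>, f5 \<sigma>] ! min k 4", OF this]
  show ?thesis by simp
qed

text \<open>The codes of \<open>R\<close> are fixed reals and serve as parameters of the
  formula.\<close>

lemma relation_definable:
  assumes "R \<subseteq> S \<times> S"
  shows "definable2 E (\<lambda>x y. (x, y) \<in> R)"
proof -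
  obtain c d e where R: "\<And>x y. (x, y) \<in> R \<longleftrightarrow> code c d e x y"
    using code_relation[OF assms] by metis
  show ?thesis unfolding R by (intro definable2I code_definable linear_term_intros)
qed

text \<open>An enumeration \<open>s\<close> lets \<open>S\<close> play the natural numbers. The
  clauses \<open>L\<close> become fixed relations on \<open>S\<close>, definable by
  \<open>relation_definable\<close>, while the quantifier over \<open>Y\<close> becomes one over
  three reals.\<close>

lemma clausal_defines_set:
  fixes X :: "(real ^ 'i) set"
  assumes "clausal S b X"
  shows "defines_set E X"
proof -
  from assms obtain L where L: "\<And>n l. l \<in> L n \<Longrightarrow> threshold_in S l"
    "\<And>x. x \<in> X \<longleftrightarrow> x \<in> open_cube b \<and> (\<exists>Y. \<forall>n::nat. \<exists>l\<in>L n. holds x Y l)"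
    unfolding clausal_iff by auto
  define s where "s = from_nat_into S"
  have bij: "bij_betw s UNIV S"
    unfolding s_def using S_countable S_infinite by (rule bij_betw_from_nat_into)
  then have s_inj: "s m = s n \<longleftrightarrow> m = n" for m n by (metis bij_betw_imp_inj_on injD)
  have s_S: "s n \<in> S" for n using bij by (metis bij_betwE UNIV_I)
  have S_s: "\<exists>n. t = s n" if "t \<in> S" for t using bij that by (metis bij_betw_imp_surj_on imageE)
  \<comment> \<open>The thresholds lie in \<open>S\<close> by \<open>threshold_in\<close>, so each
    kind of literal gives a relation on \<open>S\<close>.\<close>
  define RB where "RB i = {p. \<exists>n z. p = (s n, z) \<and> Below i z \<in> L n}" for i
  define RA where "RA i = {p. \<exists>n z. p = (s n, z) \<and> Above i z \<in> L n}" for i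
  define RP where "RP = {p. \<exists>n k. p = (s n, s k) \<and> Member k \<in> L n}"
  define RN where "RN = {p. \<exists>n k. p = (s n, s k) \<and> Nonmember k \<in> L n}"
  have "RB i \<subseteq> S \<times> S" "RA i \<subseteq> S \<times> S" for i
    using s_S L(1) unfolding RB_def RA_def by fastforce+
  note RB = this(1)[THEN relation_definable] and RA = this(2)[THEN relation_definable]
  have "RP \<subseteq> S \<times> S" "RN \<subseteq> S \<times> S" using s_S unfolding RP_def RN_def by auto
  note RP = this(1)[THEN relation_definable] and RN = this(2)[THEN relation_definable]
  obtain v :: "'i \<Rightarrow> nat" where v: "inj v"
    using finite_imp_inj_to_nat_seg[of "UNIV :: 'i set"] by auto
  \<comment> \<open>The set \<open>Y\<close> is read off the diagonal: \<open>k\<close> belongs to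
    it when the code relates \<open>s k\<close> to itself. Quantifiers over coordinates
    \<open>i\<close> are finite and unfold into disjunctions and conjunctions.\<close>
  define P where "P x \<longleftrightarrow> (\<forall>i\<in>UNIV. -b < x (v i) \<and> x (v i) < b) \<and> (\<exists>c d e. \<forall>t. t \<in> S \<longrightarrow>
      (\<exists>i\<in>UNIV. \<exists>z. (t, z) \<in> RB i \<and> x (v i) < z) \<or> (\<exists>i\<in>UNIV. \<exists>z. (t, z) \<in> RA i \<and> z < x (v i)) \<or>
      (\<exists>z. (t, z) \<in> RP \<and> code c d e z z) \<or> (\<exists>z. (t, z) \<in> RN \<and> \<not> code c d e z z))" for x :: "nat \<Rightarrow> real"
  have "definable E P"
    unfolding P_def
    by (intro definable_intros definable_finite_ex definable_finite_all finite code_definable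
        definable1D[OF S_definable] definable2D[OF RB] definable2D[OF RA] definable2D[OF RP] definable2D[OF RN])
  then obtain \<phi> where \<phi>: "\<And>\<sigma>. sat E \<sigma> \<phi> \<longleftrightarrow> P \<sigma>" unfolding definable_def by auto
  have P: "P y \<longleftrightarrow> x \<in> X" if y: "\<And>i. y (v i) = x $ i" for x y
  proof -
    have clause: "((\<exists>i\<in>UNIV. \<exists>z. (s n, z) \<in> RB i \<and> x $ i < z) \<or> (\<exists>i\<in>UNIV. \<exists>z. (s n, z) \<in> RA i \<and> z < x $ i) \<or>
      (\<exists>z. (s n, z) \<in> RP \<and> code c d e z z) \<or> (\<exists>z. (s n, z) \<in> RN \<and> \<not> code c d e z z)) \<longleftrightarrow>
      (\<exists>l\<in>L n. holds x Y l)" (is "?l \<longleftrightarrow> ?r") if Y: "\<And>k. k \<in> Y \<longleftrightarrow> code c d e (s k) (s k)" for c d e n Y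
    proof
      assume ?l
      then show ?r
        unfolding RB_def RA_def RP_def RN_def by (auto simp: s_inj Y[symmetric] intro: bexI[rotated])
    next
      assume ?r
      then obtain l where l: "l \<in> L n" "holds x Y l" by blast
      show ?l
        by (cases l) (use l in \<open>force simp: RB_def RA_def RP_def RN_def s_inj Y\<close>)+
    qed
    have "(\<exists>c d e. \<forall>t. t \<in> S \<longrightarrow>
      (\<exists>i\<in>UNIV. \<exists>z. (t, z) \<in> RB i \<and> x $ i < z) \<or> (\<exists>i\<in>UNIV. \<exists>z. (t, z) \<in> RA i \<and> z < x $ i) \<or>
      (\<exists>z. (t, z) \<in> RP \<and> code c d e z z) \<or> (\<exists>z. (t, z) \<in> RN \<and> \<not> code c d e z z)) \<longleftrightarrow>
      (\<exists>Y. \<forall>n. \<exists>l\<in>L n. holds x Y l)" (is "(\<exists>c d e. \<forall>t. t \<in> S \<longrightarrow> ?C c d e t) \<longleftrightarrow> ?R")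
    proof
      assume "\<exists>c d e. \<forall>t. t \<in> S \<longrightarrow> ?C c d e t"
      then obtain c d e where cde: "\<And>t. t \<in> S \<Longrightarrow> ?C c d e t" by auto
      have "\<exists>l\<in>L n. holds x {k. code c d e (s k) (s k)} l" for n
        using clause[of "{k. code c d e (s k) (s k)}" c d e n] cde[OF s_S[of n]] by simp
      then show ?R by blast
    next
      assume ?R
      then obtain Y where Y: "\<And>n. \<exists>l\<in>L n. holds x Y l" by blast
      have "(\<lambda>k. (s k, s k)) ` Y \<subseteq> S \<times> S" using s_S by auto
      then obtain c d e where cde: "\<And>x y. code c d e x y \<longleftrightarrow> (x, y) \<in> (\<lambda>k. (s k, s k)) ` Y"
        using code_relation by meson
      have "k \<in> Y \<longleftrightarrow> code c d e (s k) (s k)" for k unfolding cde by (auto simp: s_inj)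
      then have "?C c d e (s n)" for n using clause[of Y c d e n] Y[of n] by simp
      then have "?C c d e t" if "t \<in> S" for t using S_s[OF that] by auto
      then show "\<exists>c d e. \<forall>t. t \<in> S \<longrightarrow> ?C c d e t" by blast
    qed
    then show ?thesis unfolding P_def L(2) y open_cube_def by simp
  qed
  have "x \<in> X \<longleftrightarrow> sat E (\<lambda>k. if k \<in> range v then x $ inv v k else 0) \<phi>" for x
    unfolding \<phi> by (rule P[symmetric]) (simp add: inv_f_f[OF v])
  then show ?thesis unfolding defines_set_def using v by (intro exI[of _ \<phi>] exI[of _ v]) auto
qed

end

end

section \<open>A dense set from positive coarse dimension\<close>

definition left_gap :: "real set \<Rightarrow> real \<Rightarrow> real \<Rightarrow> bool" where
  "left_gap D s p \<longleftrightarrow> p \<in> D \<and> (\<forall>x. p - s < x \<and> x < p \<longrightarrow> \<not> x \<in> D)"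

definition gap_threshold :: "real set \<Rightarrow> real \<Rightarrow> real \<Rightarrow> bool" where
  "gap_threshold D r s \<longleftrightarrow> 0 < s \<and> s \<le> 1 \<and>
     (\<forall>d. d \<in> D \<and> -r \<le> d \<and> d \<le> r \<longrightarrow> (\<exists>p. left_gap D s p \<and> d - 1 \<le> p \<and> p \<le> d))"

text \<open>A finite set approximating \<open>D \<inter> {-r..r}\<close> up to distance 1: the right end points of those
  complementary intervals of \<open>D\<close> whose length is at least half the supremum of the
  thresholds that still allow such an approximation.\<close>

definition skeleton :: "real set \<Rightarrow> real \<Rightarrow> real \<Rightarrow> bool" where
  "skeleton D r p \<longleftrightarrow> -r - 1 \<le> p \<and> p \<le> r + 1 \<and>
     (\<exists>l. 0 < l \<and> left_gap D l p \<and> (\<forall>s. gap_threshold D r s \<longrightarrow> s \<le> 2 * l))"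

lemma left_gap_mono: "left_gap D s p \<Longrightarrow> s' \<le> s \<Longrightarrow> left_gap D s' p"
  unfolding left_gap_def by force

text \<open>Take \<open>x\<close> outside \<open>D\<close> slightly to the left of \<open>d\<close>,
  and let \<open>p\<close> be the first point of \<open>D\<close> to the right of \<open>x\<close>.
  The strict bounds on \<open>d\<close> describe an open interval, as needed for a compactness
  argument.\<close>

lemma left_gap_near:
  assumes "closed D" "interior D = {}" "d \<in> D"
  obtains p l where "0 < l" "left_gap D l p" "p - l < d" "d < p + 1"
proof -
  have "\<not> {d - 1/2<..<d} \<subseteq> D"
  proof
    assume "{d - 1/2<..<d} \<subseteq> D"
    then have "{d - 1/2<..<d} \<subseteq> interior D" by (simp add: interior_maximal)
    moreover have "d - 1/4 \<in> {d - 1/2<..<d}" by simp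
    ultimately show False using assms(2) by blast
  qed
  then obtain x where "x \<in> {d - 1/2<..<d}" "x \<notin> D" by blast
  then have x: "d - 1/2 < x" "x < d" "x \<notin> D" by simp_all
  have "open (- D)" using assms(1) by auto
  then obtain l where l: "l > 0" "ball x l \<subseteq> - D" using x(3) openE by blast
  define A where "A = D \<inter> {x..}"
  have A: "closed A" "A \<noteq> {}" "bdd_below A" "d \<in> A"
    unfolding A_def using assms x by auto
  define p where "p = Inf A"
  have pA: "p \<in> A" unfolding p_def using closed_contains_Inf[OF A(2,3,1)] .
  have pd: "p \<le> y" if "y \<in> A" for y unfolding p_def using that A(3) by (rule cInf_lower)
  have "left_gap D l p"
    unfolding left_gap_def
  proof (intro conjI allI impI)
    show "p \<in> D" using pA by (simp add: A_def)
    fix y assume y: "p - l < y \<and> y < p"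
    show "\<not> y \<in> D"
    proof
      assume yD: "y \<in> D"
      then have "y < x" using pd[of y] y by (force simp: A_def)
      moreover have "x \<le> p" using pA by (simp add: A_def)
      ultimately have "y \<in> ball x l" using y by (simp add: dist_real_def)
      then show False using l(2) yD by blast
    qed
  qed
  moreover have "p - l < d" using pd[OF A(4)] l(1) by simp
  moreover have "d < p + 1" using pA x by (simp add: A_def)
  ultimately show ?thesis using that l(1) by blast
qed

text \<open>Compactness leaves finitely many gaps to consider, and the least of their lengths and 1
  is a threshold.\<close>

lemma gap_threshold_exists:
  assumes "closed D" "interior D = {}"
  shows "\<exists>s. gap_threshold D r s"
proof -
  define K where "K = D \<inter> {-r..r}"
  have K: "compact K" unfolding K_def using assms(1) by (simp add: closed_Int_compact)
  have "\<forall>d\<in>K. \<exists>p l. 0 < l \<and> left_gap D l p \<and> p - l < d \<and> d < p + 1"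
    using left_gap_near[OF assms] unfolding K_def by (metis IntE)
  then obtain p l where pl: "\<And>d. d \<in> K \<Longrightarrow> 0 < l d \<and> left_gap D (l d) (p d) \<and> p d - l d < d \<and> d < p d + 1"
    by metis
  have "K \<subseteq> (\<Union>d\<in>K. {p d - l d<..<p d + 1})" using pl by force
  then obtain C where C: "C \<subseteq> K" "finite C" "K \<subseteq> (\<Union>d\<in>C. {p d - l d<..<p d + 1})"
    using compactE_image[OF K, of K "\<lambda>d. {p d - l d<..<p d + 1}"] by (metis open_greaterThanLessThan)
  define s where "s = Min (insert 1 (l ` C))"
  have fin: "finite (insert 1 (l ` C))" using C by simp
  have s1: "s \<le> 1" and sl: "\<And>d. d \<in> C \<Longrightarrow> s \<le> l d"
    unfolding s_def using fin by (auto intro: Min_le)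
  have "0 < s" unfolding s_def using fin C(1) pl by (subst Min_gr_iff) auto
  moreover have "\<exists>q. left_gap D s q \<and> d - 1 \<le> q \<and> q \<le> d" if d: "d \<in> D \<and> -r \<le> d \<and> d \<le> r" for d
  proof -
    have "d \<in> K" using d by (simp add: K_def)
    then obtain c where c: "c \<in> C" "p c - l c < d" "d < p c + 1" using C(3) by force
    have gap: "left_gap D (l c) (p c)" using pl c(1) C(1) by blast
    \<comment> \<open>A point of \<open>D\<close> to the right of \<open>p c - l c\<close> cannot
      lie inside the gap.\<close>
    have "p c \<le> d" using gap d c(2) unfolding left_gap_def by force
    then show ?thesis using left_gap_mono[OF gap sl[OF c(1)]] c(3) by (intro exI[of _ "p c"]) simp
  qed
  ultimately show ?thesis using s1 unfolding gap_threshold_def by blast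
qed

lemma finite_separated:
  fixes A :: "real set"
  assumes "\<delta> > 0" "A \<subseteq> {a..b}" "\<And>p q. p \<in> A \<Longrightarrow> q \<in> A \<Longrightarrow> p < q \<Longrightarrow> \<delta> \<le> q - p"
  shows "finite A"
proof -
  have lt: "\<lfloor>p / \<delta>\<rfloor> < \<lfloor>q / \<delta>\<rfloor>" if "p \<in> A" "q \<in> A" "p < q" for p q
  proof -
    have "(p + \<delta>) / \<delta> \<le> q / \<delta>" using assms(3)[OF that] assms(1) by (intro divide_right_mono) auto
    then have "p / \<delta> + 1 \<le> q / \<delta>" using assms(1) by (simp add: add_divide_distrib)
    then show ?thesis by linarith
  qed
  have "inj_on (\<lambda>p. \<lfloor>p / \<delta>\<rfloor>) A"
    by (rule inj_onI) (metis lt less_irrefl linorder_neqE_linordered_idom)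
  moreover have "(\<lambda>p. \<lfloor>p / \<delta>\<rfloor>) ` A \<subseteq> {\<lfloor>a / \<delta>\<rfloor>..\<lfloor>b / \<delta>\<rfloor>}"
  proof (rule image_subsetI)
    fix p assume "p \<in> A"
    then have "p \<in> {a..b}" using assms(2) by blast
    then show "\<lfloor>p / \<delta>\<rfloor> \<in> {\<lfloor>a / \<delta>\<rfloor>..\<lfloor>b / \<delta>\<rfloor>}"
      using assms(1) by (auto intro!: floor_mono divide_right_mono)
  qed
  ultimately show ?thesis by (meson finite_atLeastAtMost_int finite_imageD finite_subset)
qed

text \<open>The gap to the left of a skeleton point has at least half the length of any one
  threshold and contains no other skeleton point.\<close>

lemma skeleton_finite:
  assumes "closed D" "interior D = {}"
  shows "finite {p. skeleton D r p}"
proof -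
  obtain s where s: "gap_threshold D r s" using gap_threshold_exists[OF assms] by blast
  show ?thesis
  proof (rule finite_separated)
    show "s / 2 > 0" using s by (simp add: gap_threshold_def)
    show "{p. skeleton D r p} \<subseteq> {-r - 1..r + 1}" by (auto simp: skeleton_def)
    fix p q assume "p \<in> {p. skeleton D r p}" "q \<in> {p. skeleton D r p}" and pq: "p < q"
    then obtain l where "p \<in> D" "left_gap D l q" "s \<le> 2 * l"
      using s unfolding skeleton_def left_gap_def by blast
    then show "s / 2 \<le> q - p" using pq unfolding left_gap_def by force
  qed
qed

text \<open>A larger range admits fewer thresholds, so gaps long enough for \<open>r\<close> are
  long enough for \<open>r'\<close>.\<close>

lemma skeleton_mono:
  assumes "r \<le> r'" "skeleton D r p"
  shows "skeleton D r' p"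
proof -
  have "gap_threshold D r s" if "gap_threshold D r' s" for s
    using that assms(1) unfolding gap_threshold_def by (meson le_minus_iff order_trans minus_le_iff)
  then show ?thesis using assms unfolding skeleton_def by force
qed

text \<open>The supremum of the thresholds may fail to be attained, but some threshold exceeds half
  of it; the factor 2 in \<open>skeleton\<close> allows for this.\<close>

lemma skeleton_approx:
  assumes "closed D" "interior D = {}" "d \<in> D" "-r \<le> d" "d \<le> r"
  shows "\<exists>p. skeleton D r p \<and> d - 1 \<le> p \<and> p \<le> d"
proof -
  define \<sigma> where "\<sigma> = Sup {s. gap_threshold D r s}"
  have ne: "{s. gap_threshold D r s} \<noteq> {}" using gap_threshold_exists[OF assms(1,2)] by blast
  have bdd: "bdd_above {s. gap_threshold D r s}" by (rule bdd_aboveI[of _ 1]) (simp add: gap_threshold_def)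
  have up: "s \<le> \<sigma>" if "gap_threshold D r s" for s unfolding \<sigma>_def using bdd that by (auto intro: cSup_upper)
  have "\<sigma> > 0" using ne up unfolding gap_threshold_def by force
  then have "\<sigma> / 2 < Sup {s. gap_threshold D r s}" by (simp add: \<sigma>_def)
  then obtain s where s: "gap_threshold D r s" "\<sigma> / 2 < s" using less_cSup_iff[OF ne bdd] by auto
  obtain p where p: "left_gap D s p" "d - 1 \<le> p" "p \<le> d"
    using s(1) assms(3-5) unfolding gap_threshold_def by blast
  have "skeleton D r p" unfolding skeleton_def
  proof (intro conjI exI[of _ s] allI impI)
    fix s' assume "gap_threshold D r s'"
    from up[OF this] show "s' \<le> 2 * s" using s(2) by simp
  qed (use p s(1) assms(4,5) in \<open>auto simp: gap_threshold_def\<close>)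
  then show ?thesis using p by blast
qed

section \<open>Long differences almost orthogonal to a functional\<close>

text \<open>For a maximal \<open>K\<close>-separated subset \<open>A\<close> of the skeleton, every
  point of \<open>D\<close> in the ball is within \<open>K + 1\<close> of \<open>A\<close>.
  Boundedly many integer translates of \<open>A\<close> thus cover, and \<open>A\<close> is large
  when the covering number is.\<close>

lemma separated_skeleton:
  fixes K :: real
  assumes D: "closed D" "interior D = {}" and K: "K > 0"
  obtains A where "finite A" "A \<subseteq> {p. skeleton D r p}"
    "\<And>p q. p \<in> A \<Longrightarrow> q \<in> A \<Longrightarrow> p \<noteq> q \<Longrightarrow> K \<le> \<bar>p - q\<bar>"
    "cover_num (ball 0 r \<inter> D) \<le> card A * (2 * nat \<lceil>K\<rceil> + 5)"
proof -
  define F where "F = {p. skeleton D r p}"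
  define sep where "sep A \<longleftrightarrow> (\<forall>p\<in>A. \<forall>q\<in>A. p \<noteq> q \<longrightarrow> K \<le> \<bar>p - q\<bar>)" for A
  have F: "finite F" unfolding F_def by (rule skeleton_finite[OF D])
  have "finite {A. A \<subseteq> F \<and> sep A}" using F by simp
  moreover have "{A. A \<subseteq> F \<and> sep A} \<noteq> {}" by (auto simp: sep_def intro!: exI[of _ "{}"])
  ultimately have "\<exists>A\<in>{A. A \<subseteq> F \<and> sep A}. \<forall>B\<in>{A. A \<subseteq> F \<and> sep A}. A \<subseteq> B \<longrightarrow> A = B"
    by (rule finite_has_maximal)
  then obtain A where A: "A \<subseteq> F" "sep A" and max: "\<And>B. B \<subseteq> F \<Longrightarrow> sep B \<Longrightarrow> A \<subseteq> B \<Longrightarrow> A = B"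
    by auto
  have near: "\<exists>a\<in>A. \<bar>p - a\<bar> < K" if p: "p \<in> F" for p
  proof (rule ccontr)
    assume far: "\<not> (\<exists>a\<in>A. \<bar>p - a\<bar> < K)"
    then have "sep (insert p A)" using A(2) unfolding sep_def by (auto simp: abs_minus_commute not_less)
    then have "p \<in> A" using max[of "insert p A"] p A(1) by blast
    then show False using far K by force
  qed
  \<comment> \<open>The integers from \<open>-n\<close> to \<open>n\<close> number
    \<open>2 * n + 1\<close>, which is the factor in the claim.\<close>
  define n where "n = int (nat \<lceil>K\<rceil>) + 2"
  define C where "C = (\<lambda>(a, j). a + of_int j) ` (A \<times> {-n..n})"
  have finA: "finite A" using A(1) F finite_subset by blast
  have finC: "finite C" unfolding C_def using finA by simp
  have "ball 0 r \<inter> D \<subseteq> (\<Union>c\<in>C. ball c 1)"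
  proof
    fix x assume x: "x \<in> ball 0 r \<inter> D"
    then have "x \<in> D" "-r \<le> x" "x \<le> r" by (auto simp: dist_real_def abs_less_iff)
    from skeleton_approx[OF D this] obtain p where p: "p \<in> F" "x - 1 \<le> p" "p \<le> x"
      unfolding F_def by blast
    obtain a where a: "a \<in> A" "\<bar>p - a\<bar> < K" using near[OF p(1)] by blast
    have "\<bar>x - a\<bar> < K + 1" using p a by linarith
    moreover have "K \<le> of_int (n - 2)" using K by (simp add: n_def)
    ultimately have "\<lfloor>x - a\<rfloor> \<in> {-n..n}" by (auto simp: le_floor_iff floor_le_iff)
    then have "a + of_int \<lfloor>x - a\<rfloor> \<in> C" unfolding C_def using a(1) by force
    moreover have "x \<in> ball (a + of_int \<lfloor>x - a\<rfloor>) 1"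
      by (simp add: dist_real_def abs_less_iff) linarith
    ultimately show "x \<in> (\<Union>c\<in>C. ball c 1)" by blast
  qed
  then have "cover_num (ball 0 r \<inter> D) \<le> card C"
    unfolding cover_num_def using finC by (intro Least_le) blast
  also have "\<dots> \<le> card (A \<times> {-n..n})" unfolding C_def using finA by (intro card_image_le) simp
  also have "\<dots> = card A * (2 * nat \<lceil>K\<rceil> + 5)"
    by (simp add: card_cartesian_product n_def nat_add_distrib nat_mult_distrib)
  finally show ?thesis using that[of A] finA A unfolding F_def sep_def by blast
qed

text \<open>Rounding down sends the values of the functional on the \<open>k\<close>-tuples into a
  set of \<open>2 * L + 2\<close> integers. Two distinct tuples share one, and where they differ
  they differ by at least \<open>K\<close>.\<close>

lemma pigeonhole_functional:
  fixes \<mu> :: "nat \<Rightarrow> real" and L :: nat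
  assumes A: "finite A" "\<And>p. p \<in> A \<Longrightarrow> \<bar>p\<bar> \<le> R" and sep: "\<And>p q. p \<in> A \<Longrightarrow> q \<in> A \<Longrightarrow> p \<noteq> q \<Longrightarrow> K \<le> \<bar>p - q\<bar>"
    and L: "(\<Sum>i<k. \<bar>\<mu> i\<bar>) * R \<le> real L" and card: "2 * L + 2 < card A ^ k"
  shows "\<exists>v w. (\<forall>i<k. v i \<in> A \<and> w i \<in> A) \<and> \<bar>\<Sum>i<k. \<mu> i * (v i - w i)\<bar> \<le> 1 \<and> (\<exists>i<k. K \<le> \<bar>v i - w i\<bar>)"
proof -
  define X where "X = PiE {..<k} (\<lambda>_. A)"
  define h where "h v = \<lfloor>\<Sum>i<k. \<mu> i * v i\<rfloor>" for v
  have bound: "\<bar>\<Sum>i<k. \<mu> i * v i\<bar> \<le> real L" if "v \<in> X" for v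
  proof -
    have "\<bar>\<Sum>i<k. \<mu> i * v i\<bar> \<le> (\<Sum>i<k. \<bar>\<mu> i\<bar> * R)"
      using that A(2) unfolding X_def
      by (intro order_trans[OF sum_abs] sum_mono) (auto simp: abs_mult intro!: mult_left_mono)
    then show ?thesis using L by (simp add: sum_distrib_right)
  qed
  have "h ` X \<subseteq> {- int L - 1..int L}"
  proof
    fix y assume "y \<in> h ` X"
    then obtain v where v: "v \<in> X" "y = h v" by blast
    show "y \<in> {- int L - 1..int L}"
      using bound[OF v(1)] unfolding v(2) h_def by (auto simp: le_floor_iff floor_le_iff abs_le_iff)
  qed
  then have "card (h ` X) \<le> card {- int L - 1..int L}" by (intro card_mono) auto
  also have "\<dots> = 2 * L + 2" by simp
  also have "\<dots> < card X" using card by (simp add: X_def card_PiE)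
  finally have "\<not> inj_on h X" by (metis card_image less_irrefl)
  then obtain v w where vw: "v \<in> X" "w \<in> X" "h v = h w" "v \<noteq> w" unfolding inj_on_def by blast
  have "\<exists>i<k. v i \<noteq> w i"
  proof (rule ccontr)
    assume "\<not> (\<exists>i<k. v i \<noteq> w i)"
    then have "v = w" using vw(1,2) unfolding X_def by (intro PiE_ext) auto
    then show False using vw(4) by simp
  qed
  then obtain i where i: "i < k" "v i \<noteq> w i" by blast
  have mem: "\<forall>i<k. v i \<in> A \<and> w i \<in> A" using vw(1,2) unfolding X_def by auto
  have "\<bar>(\<Sum>i<k. \<mu> i * v i) - (\<Sum>i<k. \<mu> i * w i)\<bar> \<le> 1"
    using vw(3) unfolding h_def by linarith
  then have "\<bar>\<Sum>i<k. \<mu> i * (v i - w i)\<bar> \<le> 1"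
    by (simp add: right_diff_distrib sum_subtractf)
  then show ?thesis using mem i sep[of "v i" "w i"] by blast
qed

lemma cover_num_lower_bound:
  fixes Z :: "real set"
  assumes "dim_CM Z > 0"
  obtains \<epsilon> where "\<epsilon> > 0" "\<And>r0. \<exists>r>r0. r powr \<epsilon> < real (cover_num (ball 0 r \<inter> Z))"
proof -
  define f where "f r = ln (real (cover_num (ball 0 r \<inter> Z))) / ln r" for r
  obtain \<epsilon> where \<epsilon>: "0 < ereal \<epsilon>" "ereal \<epsilon> < dim_CM Z" using ereal_dense2[OF assms] by auto
  have "\<exists>r>r0. r powr \<epsilon> < real (cover_num (ball 0 r \<inter> Z))" for r0
  proof (rule ccontr)
    assume "\<not> ?thesis"
    then have le: "real (cover_num (ball 0 r \<inter> Z)) \<le> r powr \<epsilon>" if "r > r0" for r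
      using that by force
    have "eventually (\<lambda>r. ereal (f r) \<le> ereal \<epsilon>) at_top"
    proof (rule eventually_mono[OF eventually_gt_at_top[of "max 1 r0"]])
      fix r assume r: "max 1 r0 < r"
      have "ln (real (cover_num (ball 0 r \<inter> Z))) \<le> \<epsilon> * ln r"
      \<comment> \<open>The empty case rests on the convention \<open>ln 0 = 0\<close>.\<close>
      proof (cases "cover_num (ball 0 r \<inter> Z) = 0")
        case True
        then show ?thesis using r \<epsilon> by simp
      next
        case False
        then have "ln (real (cover_num (ball 0 r \<inter> Z))) \<le> ln (r powr \<epsilon>)"
          using le[of r] r by (subst ln_le_cancel_iff) auto
        then show ?thesis using r by (simp add: ln_powr)
      qed
      then show "ereal (f r) \<le> ereal \<epsilon>" unfolding f_def using r by (simp add: divide_le_eq)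
    qed
    then have "dim_CM Z \<le> ereal \<epsilon>" unfolding dim_CM_def f_def by (rule Limsup_bounded)
    then show False using \<epsilon>(2) by simp
  qed
  then show ?thesis using that \<epsilon>(1) by simp
qed

text \<open>With \<epsilon> times \<open>k\<close> at least 2, a separated subset of the skeleton
  yields at least a constant times the square of \<open>r\<close> many \<open>k\<close>-tuples for
  suitable large \<open>r\<close>, while the functional has values of order \<open>r\<close>. The
  choice of \<open>k\<close> depends only on the dimension, not on \<mu> or
  \<open>K\<close>.\<close>

lemma near_orthogonal_differences:
  assumes D: "closed D" "interior D = {}" and dim: "dim_CM D > 0"
  shows "\<exists>k::nat. \<forall>\<mu> K. \<exists>r v w. (\<forall>i<k. skeleton D r (v i) \<and> skeleton D r (w i)) \<and>
      \<bar>\<Sum>i<k. \<mu> i * (v i - w i)\<bar> \<le> 1 \<and> (\<exists>i<k. K \<le> \<bar>v i - w i\<bar>)"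
proof -
  obtain \<epsilon> where \<epsilon>: "\<epsilon> > 0" "\<And>r0. \<exists>r>r0. r powr \<epsilon> < real (cover_num (ball 0 r \<inter> D))"
    using cover_num_lower_bound[OF dim] by blast
  obtain k :: nat where k: "2 / \<epsilon> \<le> real k" using real_arch_simple by blast
  have k\<epsilon>: "2 \<le> \<epsilon> * real k" using k \<epsilon>(1) by (simp add: divide_le_eq mult.commute)
  have "\<exists>r v w. (\<forall>i<k. skeleton D r (v i) \<and> skeleton D r (w i)) \<and>
      \<bar>\<Sum>i<k. \<mu> i * (v i - w i)\<bar> \<le> 1 \<and> (\<exists>i<k. K \<le> \<bar>v i - w i\<bar>)" for \<mu> K
  proof -
    define K' where "K' = max K 1"
    define N where "N = real (2 * nat \<lceil>K'\<rceil> + 5)"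
    define M where "M = (\<Sum>i<k. \<bar>\<mu> i\<bar>)"
    have M: "M \<ge> 0" by (simp add: M_def sum_nonneg)
    have N: "N > 0" by (simp add: N_def)
    \<comment> \<open>This bound makes the number of tuples, which is at least
      \<open>r * r / N ^ k\<close>, exceed \<open>(4 * M + 4) * r\<close>.\<close>
    obtain r where r: "r > max 1 (N ^ k * (4 * M + 4))" "r powr \<epsilon> < real (cover_num (ball 0 r \<inter> D))"
      using \<epsilon>(2) by blast
    obtain A where A: "finite A" "A \<subseteq> {p. skeleton D r p}"
      "\<And>p q. p \<in> A \<Longrightarrow> q \<in> A \<Longrightarrow> p \<noteq> q \<Longrightarrow> K' \<le> \<bar>p - q\<bar>"
      "cover_num (ball 0 r \<inter> D) \<le> card A * (2 * nat \<lceil>K'\<rceil> + 5)"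
      using separated_skeleton[OF D, of K' r] unfolding K'_def by (metis max.strict_coboundedI2 zero_less_one)
    have "r powr \<epsilon> \<le> real (card A) * N"
      using r(2) A(4) unfolding N_def by (metis less_imp_le less_le_trans of_nat_le_iff of_nat_mult)
    then have "(r powr \<epsilon>) ^ k \<le> (real (card A) * N) ^ k" by (intro power_mono) auto
    moreover have "r\<^sup>2 \<le> (r powr \<epsilon>) ^ k"
    proof -
      have "r powr 2 \<le> r powr (\<epsilon> * real k)" using k\<epsilon> r(1) by (intro powr_mono) auto
      then show ?thesis using r(1) by (simp add: powr_powr[symmetric] powr_realpow)
    qed
    ultimately have "r\<^sup>2 \<le> real (card A ^ k) * N ^ k" by (simp add: power_mult_distrib)
    moreover have "(N ^ k * (4 * M + 4)) * r < r * r" using r(1) by (intro mult_strict_right_mono) auto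
    ultimately have "((4 * M + 4) * r) * N ^ k < real (card A ^ k) * N ^ k"
      by (simp add: power2_eq_square algebra_simps)
    then have big: "(4 * M + 4) * r < real (card A ^ k)" using N by simp
    define L where "L = nat \<lceil>M * (r + 1)\<rceil>"
    have L1: "M * (r + 1) \<le> real L" unfolding L_def by linarith
    have L2: "real L \<le> M * (r + 1) + 1" unfolding L_def using M r(1) by simp
    have "M \<le> M * r" using M r(1) by (simp add: mult_le_cancel_left1)
    then have "real (2 * L + 2) < (4 * M + 4) * r" using L2 r(1) by (simp add: algebra_simps)
    then have "2 * L + 2 < card A ^ k" using big by linarith
    moreover have "\<bar>p\<bar> \<le> r + 1" if "p \<in> A" for p
      using A(2) that by (auto simp: skeleton_def abs_le_iff)
    ultimately have "\<exists>v w. (\<forall>i<k. v i \<in> A \<and> w i \<in> A) \<and> \<bar>\<Sum>i<k. \<mu> i * (v i - w i)\<bar> \<le> 1 \<and>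
        (\<exists>i<k. K' \<le> \<bar>v i - w i\<bar>)"
      using pigeonhole_functional[OF A(1) _ A(3), where R = "r + 1" and k = k and \<mu> = \<mu> and L = L] L1
      unfolding M_def by simp
    then obtain v w i where vw: "\<forall>i<k. v i \<in> A \<and> w i \<in> A" "\<bar>\<Sum>i<k. \<mu> i * (v i - w i)\<bar> \<le> 1"
      "i < k" "K' \<le> \<bar>v i - w i\<bar>" by auto
    have "\<forall>i<k. skeleton D r (v i) \<and> skeleton D r (w i)" using vw(1) A(2) by blast
    moreover have "K \<le> \<bar>v i - w i\<bar>" using vw(4) by (simp add: K'_def)
    ultimately show ?thesis using vw(2,3) by blast
  qed
  then show ?thesis by blast
qed

text \<open>Moving \<open>\<mu>\<close> within a small box changes its value at a long vector, almost orthogonal to \<open>\<mu>\<close>,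
  by any prescribed amount.\<close>

lemma functional_aim:
  fixes \<Delta> :: "(nat \<Rightarrow> real) set"
  assumes \<Delta>: "\<And>\<mu> K. \<exists>x\<in>\<Delta>. \<bar>\<Sum>i<k. \<mu> i * x i\<bar> \<le> 1 \<and> (\<exists>i<k. K \<le> \<bar>x i\<bar>)"
    and "\<eta> > 0" "\<delta> > 0"
  shows "\<exists>\<mu>' \<eta>'. 0 < \<eta>' \<and> (\<forall>i. \<bar>\<mu>' i - \<mu> i\<bar> + \<eta>' \<le> \<eta>) \<and>
    (\<exists>x\<in>\<Delta>. \<forall>\<nu>. (\<forall>i. \<bar>\<nu> i - \<mu>' i\<bar> \<le> \<eta>') \<longrightarrow> \<bar>(\<Sum>i<k. \<nu> i * x i) - t\<bar> < \<delta>)"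
proof -
  obtain x j where x: "x \<in> \<Delta>" "\<bar>\<Sum>i<k. \<mu> i * x i\<bar> \<le> 1" "j < k" "2 * (\<bar>t\<bar> + 1) / \<eta> \<le> \<bar>x j\<bar>"
    using \<Delta>[of \<mu> "2 * (\<bar>t\<bar> + 1) / \<eta>"] by blast
  define y where "y = (\<Sum>i<k. \<mu> i * x i)"
  have "0 < 2 * (\<bar>t\<bar> + 1) / \<eta>" using assms(2) by simp
  then have xj: "0 < \<bar>x j\<bar>" using x(4) by linarith
  \<comment> \<open>Altering coordinate \<open>j\<close> alone moves the value from \<open>y\<close>
    to exactly \<open>t\<close>; the change is small because \<open>x j\<close> is large.\<close>
  define \<mu>' where "\<mu>' = \<mu>(j := \<mu> j + (t - y) / x j)"
  have "\<bar>t - y\<bar> \<le> \<bar>t\<bar> + 1" using x(2) unfolding y_def by linarith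
  also have "\<dots> \<le> \<bar>x j\<bar> * (\<eta> / 2)" using x(4) assms(2) by (simp add: field_simps)
  finally have move: "\<bar>(t - y) / x j\<bar> \<le> \<eta> / 2" using xj by (simp add: abs_divide divide_le_eq mult.commute)
  have aim: "(\<Sum>i<k. \<mu>' i * x i) = t"
  proof -
    have "(\<Sum>i<k. \<mu>' i * x i) = (\<Sum>i<k. \<mu> i * x i + (if i = j then t - y else 0))"
      using xj by (intro sum.cong) (auto simp: \<mu>'_def distrib_right)
    also have "\<dots> = y + (t - y)" using x(3) by (simp add: sum.distrib y_def)
    finally show ?thesis by simp
  qed
  define c where "c = (\<Sum>i<k. \<bar>x i\<bar>) + 1"
  have c: "c > 0" unfolding c_def by (simp add: sum_nonneg add_nonneg_pos)
  \<comment> \<open>The first bound keeps the new box inside the old one, the second keeps all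
    values on it within \<delta> of \<open>t\<close>.\<close>
  define \<eta>' where "\<eta>' = min (\<eta> / 2) (\<delta> / (2 * c))"
  have \<eta>': "0 < \<eta>'" "\<eta>' \<le> \<eta> / 2" "\<eta>' \<le> \<delta> / (2 * c)" using assms(2,3) c by (auto simp: \<eta>'_def)
  have "\<bar>(\<Sum>i<k. \<nu> i * x i) - t\<bar> < \<delta>" if \<nu>: "\<forall>i. \<bar>\<nu> i - \<mu>' i\<bar> \<le> \<eta>'" for \<nu>
  proof -
    have "(\<Sum>i<k. \<nu> i * x i) - t = (\<Sum>i<k. (\<nu> i - \<mu>' i) * x i)"
      unfolding aim[symmetric] by (simp add: left_diff_distrib sum_subtractf)
    also have "\<bar>\<dots>\<bar> \<le> (\<Sum>i<k. \<eta>' * \<bar>x i\<bar>)"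
      using \<nu> by (intro order_trans[OF sum_abs] sum_mono) (auto simp: abs_mult intro!: mult_right_mono)
    also have "\<dots> \<le> \<eta>' * c" using \<eta>'(1) by (simp add: c_def sum_distrib_left[symmetric])
    also have "\<dots> \<le> \<delta> / 2" using \<eta>'(3) c by (simp add: field_simps)
    finally show ?thesis using assms(3) by simp
  qed
  moreover have "\<bar>\<mu>' i - \<mu> i\<bar> + \<eta>' \<le> \<eta>" for i
  proof -
    have "\<bar>\<mu>' i - \<mu> i\<bar> \<le> \<eta> / 2" using move assms(2) by (cases "i = j") (simp_all add: \<mu>'_def)
    then show ?thesis using \<eta>'(2) by linarith
  qed
  ultimately show ?thesis using \<eta>'(1) x(1) by blast
qed

text \<open>This is the Baire type argument: boxes of functionals are nested by
  \<open>functional_aim\<close>, each step meeting one of countably many approximation demands, and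
  the common point meets all.\<close>

lemma functional_dense:
  fixes \<Delta> :: "(nat \<Rightarrow> real) set"
  assumes \<Delta>: "\<And>\<mu> K. \<exists>x\<in>\<Delta>. \<bar>\<Sum>i<k. \<mu> i * x i\<bar> \<le> 1 \<and> (\<exists>i<k. K \<le> \<bar>x i\<bar>)"
  shows "\<exists>\<nu>. \<forall>a b. a < b \<longrightarrow> (\<exists>x\<in>\<Delta>. a < (\<Sum>i<k. \<nu> i * x i) \<and> (\<Sum>i<k. \<nu> i * x i) < b)"
proof -
  \<comment> \<open>Each \<open>n\<close> encodes a pair of a rational target and a
    tolerance.\<close>
  define t where "t n = (of_rat (fst (from_nat n :: rat \<times> nat)) :: real)" for n
  define \<delta> where "\<delta> n = 1 / real (Suc (snd (from_nat n :: rat \<times> nat)))" for n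
  have \<delta>: "\<delta> n > 0" for n by (simp add: \<delta>_def)
  define step where "step n = (\<lambda>(\<mu> :: nat \<Rightarrow> real, \<eta> :: real) (\<mu>', \<eta>'). (\<forall>i. \<bar>\<mu>' i - \<mu> i\<bar> + \<eta>' \<le> \<eta>) \<and>
    (\<exists>x\<in>\<Delta>. \<forall>\<nu>. (\<forall>i. \<bar>\<nu> i - \<mu>' i\<bar> \<le> \<eta>') \<longrightarrow> \<bar>(\<Sum>i<k. \<nu> i * x i) - t n\<bar> < \<delta> n))" for n
  have "\<exists>st. \<forall>n. (\<lambda>(\<mu>, \<eta>). 0 < \<eta>) (st n) \<and> step n (st n) (st (Suc n))"
  proof (rule dependent_nat_choice)
    show "\<exists>s. (\<lambda>(\<mu> :: nat \<Rightarrow> real, \<eta> :: real). 0 < \<eta>) s" by (rule exI[of _ "(\<lambda>_. 0, 1)"]) simp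
    fix s :: "(nat \<Rightarrow> real) \<times> real" and n assume s: "(\<lambda>(\<mu>, \<eta>). 0 < \<eta>) s"
    obtain \<mu> \<eta> where s_eq: "s = (\<mu>, \<eta>)" by (cases s)
    have "0 < \<eta>" using s by (simp add: s_eq)
    from functional_aim[OF \<Delta> this \<delta>[of n], of \<mu> "t n"]
    show "\<exists>s'. (\<lambda>(\<mu>, \<eta>). 0 < \<eta>) s' \<and> step n s s'" by (auto simp: step_def s_eq)
  qed
  then obtain st where st: "\<And>n. 0 < snd (st n)" "\<And>n. step n (st n) (st (Suc n))"
    by (auto simp: case_prod_unfold)
  define \<mu> where "\<mu> n = fst (st n)" for n
  define \<eta> where "\<eta> n = snd (st n)" for n
  have pos: "0 < \<eta> n" for n using st(1) by (simp add: \<eta>_def)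
  have nest: "\<bar>\<mu> (Suc n) i - \<mu> n i\<bar> + \<eta> (Suc n) \<le> \<eta> n" for n i
    using st(2)[of n] by (simp add: step_def \<mu>_def \<eta>_def case_prod_unfold)
  have hit: "\<exists>x\<in>\<Delta>. \<forall>\<nu>. (\<forall>i. \<bar>\<nu> i - \<mu> (Suc n) i\<bar> \<le> \<eta> (Suc n)) \<longrightarrow> \<bar>(\<Sum>i<k. \<nu> i * x i) - t n\<bar> < \<delta> n" for n
    using st(2)[of n] by (simp add: step_def \<mu>_def \<eta>_def case_prod_unfold)
  \<comment> \<open>The common point is, in each coordinate, the supremum of the lower ends of the
    boxes.\<close>
  define \<nu> where "\<nu> i = (SUP n. \<mu> n i - \<eta> n)" for i
  have \<nu>: "\<bar>\<nu> i - \<mu> n i\<bar> \<le> \<eta> n" for n i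
  proof -
    have lo: "\<mu> m i - \<eta> m \<le> \<mu> m' i - \<eta> m'" if "m \<le> m'" for m m'
      by (rule lift_Suc_mono_le[OF _ that]) (use nest[of _ i] in \<open>smt (verit)\<close>)
    have hi: "\<mu> m' i + \<eta> m' \<le> \<mu> m i + \<eta> m" if "m \<le> m'" for m m'
      by (rule lift_Suc_antimono_le[OF _ that]) (use nest[of _ i] in \<open>smt (verit)\<close>)
    have lohi: "\<mu> m i - \<eta> m \<le> \<mu> n i + \<eta> n" for m n
      using lo[of m "max m n"] hi[of n "max m n"] pos[of "max m n"] by simp
    then have bdd: "bdd_above (range (\<lambda>n. \<mu> n i - \<eta> n))" by (auto simp: bdd_above_def)
    have "\<mu> n i - \<eta> n \<le> \<nu> i" unfolding \<nu>_def by (rule cSUP_upper[OF _ bdd]) simp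
    moreover have "\<nu> i \<le> \<mu> n i + \<eta> n" unfolding \<nu>_def by (rule cSUP_least) (auto simp: lohi)
    ultimately show ?thesis by (simp add: abs_le_iff)
  qed
  show ?thesis
  proof (intro exI[of _ \<nu>] allI impI)
    fix a b :: real assume "a < b"
    then obtain q where q: "a < of_rat q" "of_rat q < b" using of_rat_dense by blast
    define g where "g = min (of_rat q - a) (b - of_rat q)"
    have "0 < g" using q by (simp add: g_def)
    then obtain m where m: "inverse (real (Suc m)) < g" using reals_Archimedean by blast
    define n where "n = to_nat (q, m)"
    have n: "t n = of_rat q" "\<delta> n < g" using m by (simp_all add: t_def \<delta>_def n_def inverse_eq_divide)
    obtain x where "x \<in> \<Delta>" "\<bar>(\<Sum>i<k. \<nu> i * x i) - t n\<bar> < \<delta> n" using hit[of n] \<nu> by blast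
    then show "\<exists>x\<in>\<Delta>. a < (\<Sum>i<k. \<nu> i * x i) \<and> (\<Sum>i<k. \<nu> i * x i) < b"
      using n unfolding g_def by (intro bexI[of _ x]) (auto simp: abs_less_iff)
  qed
qed

section \<open>Finite definable families with dense union\<close>

text \<open>These are the values of the functional on differences of \<open>k\<close>-tuples from
  \<open>F\<close>. The recursion uses three real quantifiers per step, so finiteness and
  definability go by induction on \<open>k\<close>.\<close>

primrec combinations :: "(nat \<Rightarrow> real) \<Rightarrow> nat \<Rightarrow> real set \<Rightarrow> real set" where
  "combinations \<mu> 0 F = {0}"
| "combinations \<mu> (Suc k) F = {q. \<exists>q' p p'. q' \<in> combinations \<mu> k F \<and> p \<in> F \<and> p' \<in> F \<and> q = q' + \<mu> k * (p - p')}"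

lemma finite_combinations: "finite F \<Longrightarrow> finite (combinations \<mu> k F)"
proof (induction k)
  case (Suc k)
  have "combinations \<mu> (Suc k) F = (\<lambda>(q, p, p'). q + \<mu> k * (p - p')) ` (combinations \<mu> k F \<times> F \<times> F)"
    by force
  then show ?case using Suc by simp
qed simp

lemma combinations_mono: "F \<subseteq> G \<Longrightarrow> combinations \<mu> k F \<subseteq> combinations \<mu> k G"
  by (induction k) (auto, blast)

lemma sum_in_combinations:
  "(\<And>i. i < k \<Longrightarrow> v i \<in> F \<and> w i \<in> F) \<Longrightarrow> (\<Sum>i<k. \<mu> i * (v i - w i)) \<in> combinations \<mu> k F"
proof (induction k)
  case (Suc k)
  then have "(\<Sum>i<k. \<mu> i * (v i - w i)) \<in> combinations \<mu> k F" by simp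
  then show ?case using Suc.prems[of k] by auto
qed simp

lemma left_gap_definable:
  assumes "definable1 E (\<lambda>x. x \<in> D)"
  shows "definable2 E (left_gap D)"
  by (rule definable2I) (unfold left_gap_def, intro definable_intros definable1D[OF assms])

lemma gap_threshold_definable:
  assumes "definable1 E (\<lambda>x. x \<in> D)"
  shows "definable2 E (gap_threshold D)"
  by (rule definable2I)
    (unfold gap_threshold_def, intro definable_intros definable1D[OF assms] definable2D[OF left_gap_definable[OF assms]])

lemma skeleton_definable:
  assumes "definable1 E (\<lambda>x. x \<in> D)"
  shows "definable2 E (skeleton D)"
  by (rule definable2I)
    (unfold skeleton_def, intro definable_intros definable2D[OF left_gap_definable[OF assms]]
       definable2D[OF gap_threshold_definable[OF assms]])

lemma combinations_definable:
  assumes "definable2 E (\<lambda>r p. p \<in> F r)"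
  shows "definable2 E (\<lambda>r q. q \<in> combinations \<mu> k (F r))"
proof (induction k)
  case 0
  show ?case by (rule definable2I) (simp, intro definable_intros)
next
  case (Suc k)
  show ?case
    by (rule definable2I)
      (simp only: combinations.simps mem_Collect_eq, intro definable_intros definable2D[OF Suc] definable2D[OF assms])
qed

text \<open>The functional \<nu> is chosen once for the differences at all \<open>r\<close> together
  and its coefficients become scalars of the formula; only the skeleton then varies with
  \<open>r\<close>.\<close>

lemma dense_union_of_finite_definable:
  assumes D: "closed D" "interior D = {}" "dim_CM D > 0" "definable1 E (\<lambda>x. x \<in> D)"
  obtains Q :: "real \<Rightarrow> real set" where "definable2 E (\<lambda>r q. q \<in> Q r)" "\<And>r. finite (Q r)"
    "\<And>r r'. r \<le> r' \<Longrightarrow> Q r \<subseteq> Q r'" "\<And>a b. a < b \<Longrightarrow> \<exists>r. \<exists>q\<in>Q r. a < q \<and> q < b"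
proof -
  obtain k :: nat where k: "\<forall>\<mu> K. \<exists>r v w. (\<forall>i<k. skeleton D r (v i) \<and> skeleton D r (w i)) \<and>
      \<bar>\<Sum>i<k. \<mu> i * (v i - w i)\<bar> \<le> 1 \<and> (\<exists>i<k. K \<le> \<bar>v i - w i\<bar>)"
    using near_orthogonal_differences[OF D(1-3)] ..
  define \<Delta> :: "(nat \<Rightarrow> real) set" where
    "\<Delta> = {x. \<exists>v w r. x = (\<lambda>i. v i - w i) \<and> (\<forall>i<k. skeleton D r (v i) \<and> skeleton D r (w i))}"
  have long: "\<exists>x\<in>\<Delta>. \<bar>\<Sum>i<k. \<mu> i * x i\<bar> \<le> 1 \<and> (\<exists>i<k. K \<le> \<bar>x i\<bar>)" for \<mu> K
  proof -
    from k[rule_format, of \<mu> K] obtain r v w where vw: "\<forall>i<k. skeleton D r (v i) \<and> skeleton D r (w i)"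
      "\<bar>\<Sum>i<k. \<mu> i * (v i - w i)\<bar> \<le> 1 \<and> (\<exists>i<k. K \<le> \<bar>v i - w i\<bar>)"
      by blast
    have mem: "(\<lambda>i. v i - w i) \<in> \<Delta>" unfolding \<Delta>_def using vw(1) by blast
    show ?thesis by (rule bexI[OF _ mem]) (rule vw(2))
  qed
  obtain \<nu> where \<nu>: "\<And>a b. a < b \<Longrightarrow> \<exists>x\<in>\<Delta>. a < (\<Sum>i<k. \<nu> i * x i) \<and> (\<Sum>i<k. \<nu> i * x i) < b"
    using functional_dense[OF long] by auto
  define F where "F r = {p. skeleton D r p}" for r
  have F: "definable2 E (\<lambda>r p. p \<in> F r)" unfolding F_def using skeleton_definable[OF D(4)] by simp
  show ?thesis
  proof (rule that[of "\<lambda>r. combinations \<nu> k (F r)"])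
    show "finite (combinations \<nu> k (F r))" for r
      using finite_combinations skeleton_finite[OF D(1,2)] by (simp add: F_def)
    show "combinations \<nu> k (F r) \<subseteq> combinations \<nu> k (F r')" if "r \<le> r'" for r r'
      unfolding F_def by (rule combinations_mono) (use skeleton_mono[OF that] in auto)
    fix a b :: real assume "a < b"
    from \<nu>[OF this] obtain v w r where vw: "\<forall>i<k. skeleton D r (v i) \<and> skeleton D r (w i)"
      "a < (\<Sum>i<k. \<nu> i * (v i - w i))" "(\<Sum>i<k. \<nu> i * (v i - w i)) < b"
      unfolding \<Delta>_def by auto
    have "(\<Sum>i<k. \<nu> i * (v i - w i)) \<in> combinations \<nu> k (F r)"
      by (rule sum_in_combinations) (use vw(1) in \<open>simp add: F_def\<close>)
    then show "\<exists>r. \<exists>q\<in>combinations \<nu> k (F r). a < q \<and> q < b" using vw by blast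
  qed (rule combinations_definable[OF F])
qed

section \<open>Definability of bounded Borel sets\<close>

text \<open>On an interval inside the frontier both \<open>E\<close> and its complement would be
  dense.\<close>

lemma interior_frontier_empty:
  assumes "no_dense_codense E"
  shows "interior (frontier E) = {}"
proof (rule ccontr)
  assume "interior (frontier E) \<noteq> {}"
  then obtain x e where e: "e > 0" "ball x e \<subseteq> frontier E" by (meson ex_in_conv mem_interior)
  have "A \<inter> {c<..<d} \<noteq> {}" if A: "A = E \<or> A = - E" and cd: "x - e \<le> c" "c < d" "d \<le> x + e" for A c d
  proof -
    define m where "m = (c + d) / 2"
    have "c < m" "m < d" using cd(2) by (simp_all add: m_def)
    then have "x - e < m" "m < x + e" using cd(1,3) by simp_all
    then have "m \<in> ball x e" by (auto simp: dist_real_def abs_less_iff)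
    then have "m \<in> frontier E" using e by blast
    moreover have "(d - c) / 2 > 0" using cd by simp
    ultimately have "(\<exists>y\<in>E. dist m y < (d - c) / 2) \<and> (\<exists>y. y \<notin> E \<and> dist m y < (d - c) / 2)"
      unfolding frontier_straddle by blast
    then obtain y where "y \<in> A" "dist m y < (d - c) / 2" using A by blast
    then have "y \<in> A \<inter> {c<..<d}" by (auto simp: m_def dist_real_def abs_less_iff field_simps)
    then show ?thesis by blast
  qed
  then have "dense_in_interval E (x - e) (x + e) \<and> dense_in_interval (- E) (x - e) (x + e)"
    unfolding dense_in_interval_def by blast
  then show False using assms e(1) unfolding no_dense_codense_def by force
qed

lemma no_dense_codense_defines_borel:
  fixes X :: "(real ^ 'i) set"
  assumes E: "no_dense_codense E" "dim_CM (frontier E) > 0" and X: "bounded X" "X \<in> sets borel"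
  shows "defines_set E X"
proof -
  obtain Q :: "real \<Rightarrow> real set" where Q: "definable2 E (\<lambda>r q. q \<in> Q r)" "\<And>r. finite (Q r)"
    "\<And>r r'. r \<le> r' \<Longrightarrow> Q r \<subseteq> Q r'" "\<And>a b. a < b \<Longrightarrow> \<exists>r. \<exists>q\<in>Q r. a < q \<and> q < b"
    using dense_union_of_finite_definable[OF frontier_closed interior_frontier_empty[OF E(1)] E(2) frontier_definable]
    by metis
  obtain B where B: "\<And>x. x \<in> X \<Longrightarrow> norm x \<le> B" using X(1) by (auto simp: bounded_iff)
  define b where "b = \<bar>B\<bar> + 1"
  have b: "b > 0" by (simp add: b_def)
  have "X \<subseteq> open_cube b"
  proof
    fix x assume "x \<in> X"
    then have "\<bar>x $ i\<bar> < b" for i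
      using B[of x] component_le_norm_cart[of x i] unfolding b_def by linarith
    then show "x \<in> open_cube b" by (auto simp: open_cube_def abs_less_iff minus_less_iff)
  qed
  then have Xb: "X = open_cube b \<inter> X" by blast
  define S where "S = {q. (\<exists>r. q \<in> Q r) \<and> -b < q \<and> q < b}"
  \<comment> \<open>Points are ordered by their arrival in the increasing sets \<open>Q r\<close>,
    and points arriving together by size. All predecessors of a point of \<open>Q r\<close> lie in
    the finite set \<open>Q r\<close>.\<close>
  define lt where "lt y x \<longleftrightarrow> (\<exists>r. y \<in> Q r \<and> \<not> x \<in> Q r) \<or> ((\<forall>r. y \<in> Q r \<longleftrightarrow> x \<in> Q r) \<and> y < x)" for y x
  have S_dense: "\<exists>s\<in>S. x < s \<and> s < y" if "x < y" "-b \<le> x" "y \<le> b" for x y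
    using Q(4)[OF that(1)] that by (force simp: S_def)
  have "S \<subseteq> (\<Union>n::nat. Q (real n))"
  proof
    fix q assume "q \<in> S"
    then obtain r where "q \<in> Q r" by (auto simp: S_def)
    moreover obtain n :: nat where "r \<le> real n" using real_arch_simple by blast
    ultimately show "q \<in> (\<Union>n::nat. Q (real n))" using Q(3) by blast
  qed
  then have S_countable: "countable S"
    by (rule countable_subset) (use Q(2) countable_finite in auto)
  \<comment> \<open>A failure of \<open>\<theta>_inj\<close> makes \<theta> one of these countably
    many quotients, so an interval contains a good choice.\<close>
  define bad where "bad = (\<lambda>(p, p', z, z'). (p - p') / (z' - z)) ` (S \<times> S \<times> S \<times> S)"
  have "countable bad" unfolding bad_def using S_countable by (intro countable_image countable_SIGMA) auto
  then have "uncountable ({0<..<1/2} - bad)"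
    by (intro uncountable_minus_countable) (simp_all add: uncountable_open_interval)
  then obtain \<theta> :: real where \<theta>: "0 < \<theta>" "\<theta> < 1/2" "\<theta> \<notin> bad"
    by (metis DiffE equals0I countable_empty greaterThanLessThan_iff)
  have chain: "x \<in> Q r'" if "x \<in> Q r" "y \<in> Q r'" "y \<notin> Q r" for x y r r'
    using that Q(3)[of r r'] Q(3)[of r' r] by (meson linear subsetD)
  interpret omega_ordered_dense S b lt \<theta>
  proof
    show "S \<subseteq> {-b<..<b}" by (auto simp: S_def)
    show "\<not> lt x x" for x by (simp add: lt_def)
    show "lt x z" if "lt x y" "lt y z" for x y z
      using that chain unfolding lt_def by (smt (verit))
    show "lt x y \<or> lt y x" if "x \<noteq> y" for x y
      using that unfolding lt_def by (meson linorder_neqE_linordered_idom)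
    show "finite {y \<in> S. lt y x}" if x: "x \<in> S" for x
    proof -
      obtain r where r: "x \<in> Q r" using x by (auto simp: S_def)
      have "{y \<in> S. lt y x} \<subseteq> Q r" using r chain unfolding lt_def by blast
      then show ?thesis using Q(2) finite_subset by blast
    qed
    show "z = z'" if "p \<in> S" "p' \<in> S" "z \<in> S" "z' \<in> S" "p + \<theta> * z = p' + \<theta> * z'" for p p' z z'
    proof (rule ccontr)
      assume "z \<noteq> z'"
      then have "\<theta> = (p - p') / (z' - z)" using that(5) by (simp add: field_simps)
      then have "\<theta> \<in> bad" unfolding bad_def using that(1-4) by (force intro: image_eqI[of _ _ "(p, p', z, z')"])
      then show False using \<theta>(3) by simp
    qed
  qed (use b \<theta> S_dense in auto)
  have "definable1 E (\<lambda>x. x \<in> S)"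
    unfolding S_def mem_Collect_eq by (intro definable1I definable_intros definable2D[OF Q(1)])
  moreover have "definable2 E lt"
    unfolding lt_def by (intro definable2I definable_intros definable2D[OF Q(1)])
  moreover have "clausal S b X" using clausal_borel[where b = b, OF S_dense X(2)] Xb by simp
  ultimately show ?thesis by (rule clausal_defines_set)
qed

section \<open>Reduction of the nowhere dense case\<close>

text \<open>Boundedness of \<open>B\<close> provides a finite cover, so the \<open>LEAST\<close> in
  \<open>cover_num B\<close> is attained by a cover, which also covers \<open>A\<close>.\<close>

lemma cover_num_mono:
  fixes A B :: "real set"
  assumes "A \<subseteq> B" "bounded B"
  shows "cover_num A \<le> cover_num B"
proof -
  have "compact (closure B)" using assms(2) by (simp add: compact_closure)
  then obtain C where C: "finite C" "closure B \<subseteq> (\<Union>c\<in>C. ball c 1)"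
    using compact_imp_seq_compact seq_compact_imp_totally_bounded zero_less_one by metis
  then have "\<exists>C. finite C \<and> card C = card C \<and> B \<subseteq> (\<Union>c\<in>C. ball c 1)"
    using closure_subset by blast
  then have "\<exists>k C. finite C \<and> card C = k \<and> B \<subseteq> (\<Union>c\<in>C. ball c 1)" by blast
  then have "\<exists>C. finite C \<and> card C = cover_num B \<and> B \<subseteq> (\<Union>c\<in>C. ball c 1)"
    unfolding cover_num_def by (rule LeastI_ex)
  then show ?thesis unfolding cover_num_def[of A] using assms(1) by (intro Least_le) blast
qed

lemma dim_CM_mono:
  fixes A B :: "real set"
  assumes "A \<subseteq> B"
  shows "dim_CM A \<le> dim_CM B"
  unfolding dim_CM_def
proof (rule Limsup_mono, rule eventually_mono[OF eventually_gt_at_top[of 1]])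
  fix r :: real assume r: "1 < r"
  have "cover_num (ball 0 r \<inter> A) \<le> cover_num (ball 0 r \<inter> B)"
    using assms by (intro cover_num_mono) (auto intro: bounded_Int)
  then have "ln (real (cover_num (ball 0 r \<inter> A))) \<le> ln (real (cover_num (ball 0 r \<inter> B)))"
    by (cases "cover_num (ball 0 r \<inter> A) = 0"; cases "cover_num (ball 0 r \<inter> B) = 0") (auto simp: ln_ge_zero)
  then show "ereal (ln (real (cover_num (ball 0 r \<inter> A))) / ln r) \<le> ereal (ln (real (cover_num (ball 0 r \<inter> B))) / ln r)"
    using r by (simp add: divide_right_mono)
qed

lemma nowhere_dense_no_dense_codense:
  fixes E :: "real set"
  assumes "nowhere_dense E"
  shows "no_dense_codense E"
proof -
  have "\<not> dense_in_interval E a b" if ab: "a < b" for a b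
  proof
    assume d: "dense_in_interval E a b"
    have "{a<..<b} \<subseteq> closure E"
    proof
      fix x assume x: "x \<in> {a<..<b}"
      show "x \<in> closure E"
        unfolding closure_approachable
      proof (intro allI impI)
        fix e :: real assume "e > 0"
        then have "E \<inter> {x<..<min b (x + e)} \<noteq> {}"
          using d x unfolding dense_in_interval_def by auto
        then obtain y where "y \<in> E" "x < y" "y < x + e" by auto
        then show "\<exists>y\<in>E. dist y x < e" by (intro bexI[of _ y]) (auto simp: dist_real_def)
      qed
    qed
    then have "{a<..<b} \<subseteq> interior (closure E)" by (simp add: interior_maximal)
    then show False using assms ab unfolding nowhere_dense_def by simp
  qed
  then show ?thesis unfolding no_dense_codense_def by blast
qed

lemma nowhere_dense_frontier:
  assumes "nowhere_dense E"
  shows "frontier E = closure E"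
  using assms interior_mono[OF closure_subset, of E] unfolding frontier_def nowhere_dense_def by auto

theorem theorem1p4:
  fixes E :: "real set"
  shows "(no_dense_codense E \<and> dim_CM (frontier E) > 0 \<longrightarrow>
            (\<forall>X :: (real ^ 'm) set. bounded X \<and> X \<in> sets borel \<longrightarrow> defines_set E X))
       \<and> (nowhere_dense E \<and> dim_CM E > 0 \<longrightarrow>
            (\<forall>X :: (real ^ 'm) set. bounded X \<and> X \<in> sets borel \<longrightarrow> defines_set E X))"
proof -
  \<comment> \<open>For nowhere dense \<open>E\<close> the frontier is the closure, which contains
    \<open>E\<close> and so has at least its dimension.\<close>
  have "dim_CM (frontier E) > 0" if "nowhere_dense E" "dim_CM E > 0"
    using that dim_CM_mono[OF closure_subset, of E] nowhere_dense_frontier by (metis less_le_trans)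
  then show ?thesis
    using no_dense_codense_defines_borel nowhere_dense_no_dense_codense by blast
qed

end
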